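(* Let $p,q>1$ with $1/p+1/q=1$ and $T>0$. Let $(U,d)$ be a complete metric space endowed with a Hausdorff topology $\sigma$ compatible with $d$, in the sense that $u_n\stackrel{\sigma}{\to}u$ and $v_n\stackrel{\sigma}{\to}v$ imply $d(u,v)\le\liminf_{n\to\infty}d(u_n,v_n)$. Let $\phi:U\to(-\infty,\infty]$ be proper, with sequentially $\sigma$-compact sublevels, and such that the local slope $|\partial\phi|$ is a strong upper gradient for $\phi$ and is sequentially $\sigma$-lower semicontinuous on $d$-bounded sublevels of $\phi$. Let $u^0\in D(\phi)$. Let $\{0=t_0^n<t_1^n<\dots<t^n_{N^n}=T\}$, $n\in\mathbb{N}$, be a sequence of partitions with steps $\tau_i^n=t_i^n-t_{i-1}^n$ and $\tau^n:=\max_i\tau_i^n\to0$ as $n\to\infty$. Let $\{u_i^n\}_{i=0}^{N^n}$ (with $u_0^n\in D(\phi)$ and $u_i^n\in D(|\partial\phi|)$ for $i\geq 1$) be such that the $u_0^n$ are $d$-bounded, $u_0^n\stackrel{\sigma}{\to}u^0$, $\phi(u_0^n)\to\phi(u^0)$, and $$\sum_{i=1}^{N^n}\big(G(\tau_i^n,u_{i-1}^n,u_i^n)\big)^+\to0\quad\text{as }n\to\infty .$$ Then, up to a (not relabeled) subsequence, $\overline u^n(t)\stackrel{\sigma}{\to}u(t)$ for all $t\in[0,T]$, where $\overline u^n$ is the backward piecewise constant interpolant of $\{u_i^n\}$ and $u$ is a curve of maximal slope with $u(0)=u^0$.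
   Context: Notation: $r^+=\max\{r,0\}$. $D(\phi)=\{u\in U:\phi(u)<\infty\}$; $\phi$ is proper if $D(\phi)\neq\emptyset$. $AC^p([0,T];U)$ is the set of curves $u:[0,T]\to U$ for which there is $m\in L^p(0,T)$ with $d(u(s),u(t))\le\int_s^t m(r)\,dr$ for all $0\le s\le t\le T$. For such $u$ the metric derivative $|u'|(t)=\lim_{s\to t}d(u(s),u(t))/|t-s|$ exists for a.e. $t\in(0,T)$ and belongs to $L^p(0,T)$. Local slope: for $u\in D(\phi)$, $|\partial\phi|(u):=\limsup_{v\to u}\frac{(\phi(u)-\phi(v))^+}{d(u,v)}$ (convergence $v\to u$ in $d$), and $D(|\partial\phi|)=\{u\in D(\phi):|\partial\phi|(u)<\infty\}$. $|\partial\phi|$ is a strong upper gradient for $\phi$ if for all $u\in AC^p([0,T];U)$ the map $r\mapsto|\partial\phi|(u(r))$ is Borel and $|\phi(u(t))-\phi(u(s))|\le\int_s^t|\partial\phi|(u(r))\,|u'|(r)\,dr$ for all $0\le s\le t\le T$. Incremental functional: for $\tau>0$, $v\in D(\phi)$, $u\in D(|\partial\phi|)$, $$G(\tau,v,u)=\phi(u)+\frac{\tau^{1-p}}{p}d^p(v,u)+\frac{\tau}{q}|\partial\phi|^q(u)-\phi(v).$$ Backward piecewise constant interpolant: $\overline u^n(0)=u_0^n$ and $\overline u^n(t)=u_i^n$ for $t\in(t_{i-1}^n,t_i^n]$, $i=1,\dots,N^n$. Curve of maximal slope: $u\in AC^p([0,T];U)$ such that $\phi\circ u\in W^{1,1}(0,T)$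 and $$\phi(u(t))+\frac1p\int_0^t|u'|^p(r)\,dr+\frac1q\int_0^t|\partial\phi|^q(u(r))\,dr=\phi(u(0))\quad\forall t\in[0,T].$$ *)

theory Defs
  imports "HOL-Analysis.Analysis"
begin

section \<open>The auxiliary topology\<close>

definition dist_compatible :: "'a::metric_space topology \<Rightarrow> bool" where
  "dist_compatible \<sigma> \<longleftrightarrow>
     (\<forall>x y u v. limitin \<sigma> x u sequentially \<and> limitin \<sigma> y v sequentially \<longrightarrow>
        ereal (dist u v) \<le> liminf (\<lambda>n. ereal (dist (x n) (y n))))"

definition seq_compact_in :: "'a topology \<Rightarrow> 'a set \<Rightarrow> bool" where
  "seq_compact_in \<sigma> S \<longleftrightarrow>
     (\<forall>x::nat \<Rightarrow> 'a. range x \<subseteq> S \<longrightarrow>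
        (\<exists>l\<in>S. \<exists>k. strict_mono k \<and> limitin \<sigma> (x \<circ> k) l sequentially))"

definition seq_lsc_on :: "'a topology \<Rightarrow> 'a set \<Rightarrow> ('a \<Rightarrow> ennreal) \<Rightarrow> bool" where
  "seq_lsc_on \<sigma> S g \<longleftrightarrow>
     (\<forall>x l. range x \<subseteq> S \<and> l \<in> S \<and> limitin \<sigma> x l sequentially \<longrightarrow>
        g l \<le> liminf (\<lambda>n. g (x n)))"


section \<open>The functional and its local slope\<close>

text \<open>Functionals with values in \<open>(-\<infinity>,\<infinity>]\<close> are functions into \<^typ>\<open>ereal\<close> that
  avoid \<open>-\<infinity>\<close>.\<close>

definition sublevel :: "('a \<Rightarrow> ereal) \<Rightarrow> real \<Rightarrow> 'a set" where
  "sublevel \<phi> c = {u. \<phi> u \<le> ereal c}"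

definition eff_dom :: "('a \<Rightarrow> ereal) \<Rightarrow> 'a set" where
  "eff_dom \<phi> = {u. \<phi> u < \<infinity>}"

text \<open>The slope takes values in \<open>[0,\<infinity>]\<close>, so that it is \<open>0\<close> at isolated points (where
  \<open>at u\<close> is trivial and the \<open>Limsup\<close> is the least element); it is extended by \<open>\<infinity>\<close>
  outside the domain of \<open>\<phi>\<close>.\<close>

definition local_slope :: "('a::metric_space \<Rightarrow> ereal) \<Rightarrow> 'a \<Rightarrow> ennreal" where
  "local_slope \<phi> u =
     (if \<phi> u < \<infinity>
      then Limsup (at u) (\<lambda>v. e2ennreal (max 0 (\<phi> u - \<phi> v)) / ennreal (dist u v))
      else \<infinity>)"

definition slope_dom :: "('a::metric_space \<Rightarrow> ereal) \<Rightarrow> 'a set" where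
  "slope_dom \<phi> = {u \<in> eff_dom \<phi>. local_slope \<phi> u < \<infinity>}"


section \<open>Curves\<close>

text \<open>Curves on \<open>[0,T]\<close> are functions on \<^typ>\<open>real\<close> of which only the restriction to
  \<open>{0..T}\<close> matters.  Every class in \<open>L\<^sup>p(0,T)\<close> has a Borel representative, hence the
  use of \<open>lborel\<close>.\<close>

definition Lp_fun :: "real \<Rightarrow> real \<Rightarrow> (real \<Rightarrow> real) \<Rightarrow> bool" where
  "Lp_fun p T m \<longleftrightarrow>
     set_borel_measurable lborel {0<..<T} m \<and>
     set_integrable lborel {0<..<T} (\<lambda>r. \<bar>m r\<bar> powr p)"

definition AC :: "real \<Rightarrow> real \<Rightarrow> (real \<Rightarrow> 'a::metric_space) \<Rightarrow> bool" where
  "AC p T u \<longleftrightarrow>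
     (\<exists>m. Lp_fun p T m \<and>
        (\<forall>s t. 0 \<le> s \<and> s \<le> t \<and> t \<le> T \<longrightarrow>
           dist (u s) (u t) \<le> (LINT r:{s..t}|lborel. m r)))"

text \<open>Meaningful where the limit exists, that is, almost everywhere in \<open>(0,T)\<close> if
  \<open>u\<close> is absolutely continuous on \<open>[0,T]\<close>; it is used only under integrals.\<close>

definition metric_deriv :: "(real \<Rightarrow> 'a::metric_space) \<Rightarrow> real \<Rightarrow> real" where
  "metric_deriv u t = Lim (at t) (\<lambda>s. dist (u s) (u t) / \<bar>t - s\<bar>)"

text \<open>\<open>\<bar>a - b\<bar>\<close> for extended reals, with \<open>\<bar>\<infinity> - \<infinity>\<bar> = 0\<close>; in \<^typ>\<open>ereal\<close> one has
  \<open>\<infinity> - \<infinity> = \<infinity>\<close>, and then not even a constant curve outside the domain of \<open>\<phi>\<close>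
  would satisfy the strong upper gradient inequality.\<close>

definition abs_diff :: "ereal \<Rightarrow> ereal \<Rightarrow> ereal" where
  "abs_diff a b = (if a = b then 0 else \<bar>a - b\<bar>)"

definition strong_upper_gradient ::
    "real \<Rightarrow> real \<Rightarrow> ('a::metric_space \<Rightarrow> ereal) \<Rightarrow> ('a \<Rightarrow> ennreal) \<Rightarrow> bool" where
  "strong_upper_gradient p T \<phi> g \<longleftrightarrow>
     (\<forall>u. AC p T u \<longrightarrow>
        (\<lambda>r. g (u r)) \<in> borel_measurable (restrict_space borel {0..T}) \<and>
        (\<forall>s t. 0 \<le> s \<and> s \<le> t \<and> t \<le> T \<longrightarrow>
           abs_diff (\<phi> (u t)) (\<phi> (u s)) \<le>
             enn2ereal (\<integral>\<^sup>+r\<in>{s..t}. (g (u r) * ennreal (metric_deriv u r)) \<partial>lborel)))"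

definition ennreal_powr :: "ennreal \<Rightarrow> real \<Rightarrow> ennreal" where
  "ennreal_powr x a = (if x = \<infinity> then \<infinity> else ennreal (enn2real x powr a))"

definition test_function :: "real \<Rightarrow> (real \<Rightarrow> real) \<Rightarrow> bool" where
  "test_function T \<zeta> \<longleftrightarrow>
     (\<forall>k x. ((deriv ^^ k) \<zeta>) differentiable (at x)) \<and>
     (\<exists>a b. 0 < a \<and> b < T \<and> (\<forall>x. x \<notin> {a..b} \<longrightarrow> \<zeta> x = 0))"

text \<open>The Sobolev space \<open>W\<^sup>1\<^sup>,\<^sup>1(0,T)\<close>, by weak derivatives.  An extended real function
  belongs to it if it is finite almost everywhere and its real part does.\<close>

definition W11 :: "real \<Rightarrow> (real \<Rightarrow> ereal) \<Rightarrow> bool" where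
  "W11 T f \<longleftrightarrow>
     (AE x in lborel. x \<in> {0<..<T} \<longrightarrow> \<bar>f x\<bar> \<noteq> \<infinity>) \<and>
     set_integrable lborel {0<..<T} (\<lambda>x. real_of_ereal (f x)) \<and>
     (\<exists>g. set_integrable lborel {0<..<T} g \<and>
        (\<forall>\<zeta>. test_function T \<zeta> \<longrightarrow>
           (LINT x:{0<..<T}|lborel. real_of_ereal (f x) * deriv \<zeta> x) =
             - (LINT x:{0<..<T}|lborel. g x * \<zeta> x)))"

definition curve_of_maximal_slope ::
    "real \<Rightarrow> real \<Rightarrow> real \<Rightarrow> ('a::metric_space \<Rightarrow> ereal) \<Rightarrow> (real \<Rightarrow> 'a) \<Rightarrow> bool" where
  "curve_of_maximal_slope p q T \<phi> u \<longleftrightarrow>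
     AC p T u \<and> W11 T (\<lambda>t. \<phi> (u t)) \<and>
     (\<forall>t\<in>{0..T}.
        \<phi> (u t)
        + enn2ereal (ennreal (1/p) * (\<integral>\<^sup>+r\<in>{0..t}. ennreal (metric_deriv u r powr p) \<partial>lborel))
        + enn2ereal (ennreal (1/q) * (\<integral>\<^sup>+r\<in>{0..t}. ennreal_powr (local_slope \<phi> (u r)) q \<partial>lborel))
        = \<phi> (u 0))"


section \<open>Discretization\<close>

definition time_partition :: "real \<Rightarrow> nat \<Rightarrow> (nat \<Rightarrow> real) \<Rightarrow> bool" where
  "time_partition T N t \<longleftrightarrow> t 0 = 0 \<and> t N = T \<and> (\<forall>i<N. t i < t (Suc i))"

definition step :: "(nat \<Rightarrow> real) \<Rightarrow> nat \<Rightarrow> real" where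
  "step t i = t i - t (i - 1)"

definition fineness :: "nat \<Rightarrow> (nat \<Rightarrow> real) \<Rightarrow> real" where
  "fineness N t = Max (step t ` {1..N})"

text \<open>Only used for \<open>v \<in> eff_dom \<phi>\<close> and \<open>u \<in> slope_dom \<phi>\<close>, where all terms are finite.\<close>

definition incr_G ::
    "real \<Rightarrow> real \<Rightarrow> ('a::metric_space \<Rightarrow> ereal) \<Rightarrow> real \<Rightarrow> 'a \<Rightarrow> 'a \<Rightarrow> real" where
  "incr_G p q \<phi> \<tau> v u =
     real_of_ereal (\<phi> u) + \<tau> powr (1 - p) / p * dist v u powr p
     + \<tau> / q * enn2real (local_slope \<phi> u) powr q - real_of_ereal (\<phi> v)"

definition backward_interp ::
    "nat \<Rightarrow> (nat \<Rightarrow> real) \<Rightarrow> (nat \<Rightarrow> 'a) \<Rightarrow> real \<Rightarrow> 'a" where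
  "backward_interp N t u s =
     (if s = 0 then u 0 else u (THE i. i \<in> {1..N} \<and> s \<in> {t (i - 1)<..t i}))"

end

theory Submission
  imports Defs "HOL-Library.Diagonal_Subsequence"
begin

text \<open>
  Write \<open>d\<close> for the distance.  Summing the definition of the incremental functional over the
  first \<open>m\<close> steps gives
  \<open>\<phi>(u\<^sub>m) + K\<^sub>m/p + S\<^sub>m/q \<le> \<phi>(u\<^sub>0) + \<epsilon>\<close>, where
  \<open>K\<^sub>m = \<Sum> \<tau>\<^sub>i\<^sup>1\<^sup>-\<^sup>p d(u\<^sub>i\<^sub>-\<^sub>1,u\<^sub>i)\<^sup>p\<close> is the discrete kinetic energy, \<open>S\<^sub>m = \<Sum> \<tau>\<^sub>i \<bar>\<partial>\<phi>\<bar>\<^sup>q(u\<^sub>i)\<close>, and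
  \<open>\<epsilon>\<close> is the sum of the positive parts of the errors, which vanishes in the limit
  (\<open>discrete_energy_inequality\<close>).  As \<open>\<phi>\<close> is bounded below, all three terms
  are bounded.  The bound on the kinetic energy makes the interpolants equicontinuous up to
  the mesh size, so that a diagonal argument in a compact sublevel
  yields a pointwise limit curve \<open>w\<close> (\<open>pointwise_compactness\<close>).

  The kinetic energy passes to the limit without weak compactness in \<open>L\<^sup>p\<close>.  The tangent
  inequality \<open>p c\<^sup>p\<^sup>-\<^sup>1 z \<le> z\<^sup>p + (p - 1) c\<^sup>p\<close>, applied to the speed of each step and
  multiplied by the step length, is additive over the steps: \<open>p c\<^sup>p\<^sup>-\<^sup>1 d(u\<^sub>i,u\<^sub>j) \<le> (K\<^sub>j - K\<^sub>i) + (p - 1) c\<^sup>p (t\<^sub>j - t\<^sub>i)\<close> for all \<open>c > 0\<close>.  The lower limit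
  is superadditive, so \<open>E(s) = liminf K(s)\<close>, taken pointwise in time, satisfies the same inequality
  with \<open>w\<close> in place of the scheme (\<open>E_increment\<close>).  By itself this inequality implies that \<open>w\<close> is absolutely
  continuous, that its metric derivative exists almost everywhere, and that the integral of
  \<open>\<bar>w'\<bar>\<^sup>p\<close> over \<open>[0,s]\<close> is at most \<open>E(s) - E(0)\<close> (\<open>metric_derivative_energy\<close>).

  Fatou's lemma and the lower semicontinuity of the slope take care of \<open>S\<close>, and the lower
  semicontinuity of \<open>\<phi>\<close>, which follows from the compactness of its sublevels, of the first
  term.  This gives one inequality in the energy identity
  (\<open>limit_energy_inequality\<close>).  The other one is the strong upper gradient inequality along \<open>w\<close>,
  combined with Young's inequality.  Equality exhibits \<open>\<phi> \<circ> w\<close> as a constant minus the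
  primitive of an integrable function, whence it lies in \<open>W\<^sup>1\<^sup>,\<^sup>1\<close>
  (\<open>integral_primitive_times_deriv\<close>).

  The existence of the metric derivative rests on the Vitali covering theorem through one
  lemma, \<open>covered_superadditive\<close>: the points that lie in arbitrarily small intervals on
  which a nonnegative superadditive interval function \<open>\<sigma>\<close> is at least \<open>e\<close> times the length form a
  set of outer measure at most \<open>\<sigma>(\<alpha>,\<beta>)/e\<close>.  With \<open>\<sigma>\<close> the increment of a monotone function it gives the
  almost everywhere differentiability of such functions.  With \<open>\<sigma>\<close> the excess of arc length over
  distance it shows that arc length and distance have the same derivative.
\<close>

section \<open>Covering by intervals on which a superadditive function is large\<close>

text \<open>Lebesgue outer measure at most \<open>c\<close>, for sets whose measurability is not known.\<close>

definition covered :: "real set \<Rightarrow> real \<Rightarrow> bool" where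
  "covered S c \<longleftrightarrow> (\<exists>E\<in>lmeasurable. S \<subseteq> E \<and> measure lebesgue E \<le> c)"

lemma covered_mono: "covered S c \<Longrightarrow> S' \<subseteq> S \<Longrightarrow> c \<le> c' \<Longrightarrow> covered S' c'"
  unfolding covered_def by (meson order_trans)

lemma covered_nonneg: "covered S c \<Longrightarrow> 0 \<le> c"
  unfolding covered_def by (meson measure_nonneg order_trans)

lemma covered_negligible: "negligible N \<Longrightarrow> covered N 0"
  unfolding covered_def
  by (metis negligible_iff_measure order_refl)

lemma covered_interval: "l \<le> r \<Longrightarrow> covered {l<..<r} (r - l)"
  unfolding covered_def by (intro bexI[of _ "{l..r}"]) auto

lemma covered_Un:
  assumes "covered S c" "covered S' c'"
  shows "covered (S \<union> S') (c + c')"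
proof -
  obtain E E' where E: "E \<in> lmeasurable" "S \<subseteq> E" "measure lebesgue E \<le> c"
      "E' \<in> lmeasurable" "S' \<subseteq> E'" "measure lebesgue E' \<le> c'"
    using assms unfolding covered_def by blast
  have "measure lebesgue (E \<union> E') \<le> c + c'"
    using measure_Un_le[of E lebesgue E'] E by (auto simp: fmeasurableD)
  with E show ?thesis
    unfolding covered_def by (intro bexI[of _ "E \<union> E'"]) auto
qed

lemma covered_UN:
  assumes C: "countable C" and S: "\<And>i. i \<in> C \<Longrightarrow> covered (S i) (c i)"
    and B: "\<And>F. finite F \<Longrightarrow> F \<subseteq> C \<Longrightarrow> sum c F \<le> B"
  shows "covered (\<Union>i\<in>C. S i) B"
proof -
  obtain E where E: "\<And>i. i \<in> C \<Longrightarrow> E i \<in> lmeasurable \<and> S i \<subseteq> E i \<and> measure lebesgue (E i) \<le> c i"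
    using S unfolding covered_def by metis
  have fin: "measure lebesgue (\<Union>i\<in>F. E i) \<le> B" if "finite F" "F \<subseteq> C" for F
  proof -
    have "measure lebesgue (\<Union>i\<in>F. E i) \<le> (\<Sum>i\<in>F. measure lebesgue (E i))"
      using that E by (intro measure_UNION_le) (auto simp: fmeasurableD)
    also have "\<dots> \<le> sum c F"
      using that E by (intro sum_mono) auto
    finally show ?thesis using B[OF that] by linarith
  qed
  have "(\<Union>i\<in>C. E i) \<in> lmeasurable" "measure lebesgue (\<Union>i\<in>C. E i) \<le> B"
    using fmeasurable_UN_bound[OF C _ fin] measure_UN_bound[OF C _ fin] E by auto
  with E show ?thesis unfolding covered_def by blast
qed

lemma negligible_if_covered:
  assumes "\<And>e. e > 0 \<Longrightarrow> covered S e"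
  shows "negligible S"
  unfolding negligible_outer_le using assms unfolding covered_def by blast

text \<open>A superadditive function loses nothing when gaps are dropped, because it is nonnegative on
  them.\<close>

lemma sum_superadditive_le:
  fixes \<sigma> :: "real \<Rightarrow> real \<Rightarrow> real" and l r :: "'i \<Rightarrow> real"
  assumes "finite F" "\<alpha> \<le> \<beta>"
    and nn: "\<And>a b. \<alpha> \<le> a \<Longrightarrow> a \<le> b \<Longrightarrow> b \<le> \<beta> \<Longrightarrow> 0 \<le> \<sigma> a b"
    and add: "\<And>a b c. \<alpha> \<le> a \<Longrightarrow> a \<le> b \<Longrightarrow> b \<le> c \<Longrightarrow> c \<le> \<beta> \<Longrightarrow> \<sigma> a b + \<sigma> b c \<le> \<sigma> a c"
    and F: "\<And>i. i \<in> F \<Longrightarrow> \<alpha> \<le> l i \<and> l i \<le> r i \<and> r i \<le> \<beta>"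
    and disj: "pairwise (\<lambda>i j. disjnt {l i..r i} {l j..r j}) F"
  shows "(\<Sum>i\<in>F. \<sigma> (l i) (r i)) \<le> \<sigma> \<alpha> \<beta>"
  using assms(1,2) nn add F disj
proof (induction "card F" arbitrary: F \<beta>)
  case 0
  then show ?case by simp
next
  case (Suc n)
  then have ne: "F \<noteq> {}" by auto
  \<comment> \<open>Split off the rightmost interval; all the others lie to the left of it.\<close>
  obtain i where i: "i \<in> F" "\<And>j. j \<in> F \<Longrightarrow> l j \<le> l i"
  proof -
    have "Max (l ` F) \<in> l ` F" using Suc.prems(1) ne by simp
    then obtain i where "i \<in> F" "l i = Max (l ` F)" by auto
    then show ?thesis using that[of i] Suc.prems(1) by simp
  qed
  have left: "r j \<le> l i" if "j \<in> F - {i}" for j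
  proof (rule ccontr)
    assume "\<not> r j \<le> l i"
    then have "l i \<in> {l j..r j} \<inter> {l i..r i}" using i that Suc.prems(5) by force
    then show False
      using Suc.prems(6) i(1) that unfolding pairwise_def disjnt_def by blast
  qed
  have b: "\<alpha> \<le> l i" "l i \<le> r i" "r i \<le> \<beta>" using Suc.prems(5) i(1) by auto
  have IH: "(\<Sum>j\<in>F - {i}. \<sigma> (l j) (r j)) \<le> \<sigma> \<alpha> (l i)"
  proof (rule Suc.hyps(1))
    show "n = card (F - {i})" using Suc.hyps(2) i(1) Suc.prems(1) by simp
    show "pairwise (\<lambda>i j. disjnt {l i..r i} {l j..r j}) (F - {i})"
      using Suc.prems(6) by (rule pairwise_subset) auto
  qed (use b left Suc.prems in auto)
  have "(\<Sum>j\<in>F. \<sigma> (l j) (r j)) = (\<Sum>j\<in>F - {i}. \<sigma> (l j) (r j)) + \<sigma> (l i) (r i)"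
    using Suc.prems(1) i(1) by (simp add: sum.remove)
  also have "\<dots> \<le> \<sigma> \<alpha> (l i) + \<sigma> (l i) (r i) + \<sigma> (r i) \<beta>"
    using IH Suc.prems(3)[of "r i" \<beta>] b by auto
  also have "\<dots> \<le> \<sigma> \<alpha> (r i) + \<sigma> (r i) \<beta>"
    using Suc.prems(4)[of \<alpha> "l i" "r i"] b by auto
  also have "\<dots> \<le> \<sigma> \<alpha> \<beta>"
    using Suc.prems(4)[of \<alpha> "r i" \<beta>] b by auto
  finally show ?case .
qed

text \<open>In dimension one closed balls are compact intervals, and a point of \<open>S\<close> may be an endpoint of the
  intervals that surround it.\<close>

lemma Vitali_intervals:
  fixes K :: "(real \<times> real) set"
  assumes K: "\<And>l r. (l, r) \<in> K \<Longrightarrow> l < r"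
    and S: "\<And>x d. x \<in> S \<Longrightarrow> 0 < d \<Longrightarrow> \<exists>l r. (l, r) \<in> K \<and> l \<le> x \<and> x \<le> r \<and> r - l < d"
  obtains C where "countable C" "C \<subseteq> K"
    "pairwise (\<lambda>i j. disjnt {fst i..snd i} {fst j..snd j}) C"
    "negligible (S - (\<Union>i\<in>C. {fst i..snd i}))"
proof -
  have eq: "cball ((fst i + snd i) / 2) ((snd i - fst i) / 2) = {fst i..snd i}" for i :: "real \<times> real"
    by (simp add: cball_eq_atLeastAtMost field_simps)
  have "\<exists>i. i \<in> K \<and> x \<in> cball ((fst i + snd i) / 2) ((snd i - fst i) / 2) \<and> (snd i - fst i) / 2 < d"
    if xd: "x \<in> S" "0 < d" for x d
  proof -
    obtain l r where "(l, r) \<in> K" "l \<le> x" "x \<le> r" "r - l < d" using S[OF xd] by blast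
    then show ?thesis unfolding eq using K by (intro exI[of _ "(l, r)"]) force
  qed
  from Vitali_covering_theorem_cballs[of K "\<lambda>i. (snd i - fst i) / 2" S "\<lambda>i. (fst i + snd i) / 2", OF _ this]
  show ?thesis
    using that K unfolding eq by force
qed

text \<open>Vitali's theorem selects disjoint intervals that exhaust \<open>S\<close>; on each of them the length is at most
  \<open>\<sigma>/e\<close>, and the values of \<open>\<sigma>\<close> add up to at most \<open>\<sigma> \<alpha> \<beta>\<close>.\<close>

lemma covered_superadditive:
  fixes \<sigma> :: "real \<Rightarrow> real \<Rightarrow> real"
  assumes "\<alpha> \<le> \<beta>" "e > 0"
    and nn: "\<And>a b. \<alpha> \<le> a \<Longrightarrow> a \<le> b \<Longrightarrow> b \<le> \<beta> \<Longrightarrow> 0 \<le> \<sigma> a b"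
    and add: "\<And>a b c. \<alpha> \<le> a \<Longrightarrow> a \<le> b \<Longrightarrow> b \<le> c \<Longrightarrow> c \<le> \<beta> \<Longrightarrow> \<sigma> a b + \<sigma> b c \<le> \<sigma> a c"
    and sub: "S \<subseteq> {\<alpha><..<\<beta>}"
    and S: "\<And>x d. x \<in> S \<Longrightarrow> 0 < d \<Longrightarrow>
              \<exists>l r. l < r \<and> l \<le> x \<and> x \<le> r \<and> r - l < d \<and> \<sigma> l r \<ge> e * (r - l)"
  shows "covered S (\<sigma> \<alpha> \<beta> / e)"
proof -
  let ?K = "{(l, r). \<alpha> \<le> l \<and> l < r \<and> r \<le> \<beta> \<and> \<sigma> l r \<ge> e * (r - l)}"
  have "\<exists>l r. (l, r) \<in> ?K \<and> l \<le> x \<and> x \<le> r \<and> r - l < d" if "x \<in> S" "0 < d" for x d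
  proof -
    have "0 < min d (min (x - \<alpha>) (\<beta> - x))" using sub that by auto
    from S[OF that(1) this] obtain l r where
      "l < r" "l \<le> x" "x \<le> r" "r - l < min d (min (x - \<alpha>) (\<beta> - x))" "\<sigma> l r \<ge> e * (r - l)"
      by blast
    then show ?thesis by (intro exI[of _ l] exI[of _ r]) auto
  qed
  from Vitali_intervals[of ?K, OF _ this]
  obtain C where C: "countable C" "C \<subseteq> ?K"
    "pairwise (\<lambda>i j. disjnt {fst i..snd i} {fst j..snd j}) C"
    "negligible (S - (\<Union>i\<in>C. {fst i..snd i}))"
    by auto
  have "covered (\<Union>i\<in>C. {fst i..snd i}) (\<sigma> \<alpha> \<beta> / e)"
  proof (rule covered_UN[OF C(1)])
    fix i assume "i \<in> C"
    then show "covered {fst i..snd i} (snd i - fst i)"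
      using C(2) unfolding covered_def by (intro bexI[of _ "{fst i..snd i}"]) auto
  next
    fix F assume F: "finite F" "F \<subseteq> C"
    have "e * (\<Sum>i\<in>F. snd i - fst i) \<le> (\<Sum>i\<in>F. \<sigma> (fst i) (snd i))"
      unfolding sum_distrib_left using F C(2) by (intro sum_mono) auto
    also have "\<dots> \<le> \<sigma> \<alpha> \<beta>"
      by (rule sum_superadditive_le[OF F(1) \<open>\<alpha> \<le> \<beta>\<close> nn add _ pairwise_subset[OF C(3) F(2)]])
         (use F C in auto)
    finally show "(\<Sum>i\<in>F. snd i - fst i) \<le> \<sigma> \<alpha> \<beta> / e"
      using \<open>e > 0\<close> by (simp add: field_simps)
  qed
  from covered_Un[OF this covered_negligible[OF C(4)]] show ?thesis
    by (rule covered_mono) auto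
qed

section \<open>Lebesgue differentiation and the fundamental theorem of calculus\<close>

text \<open>Cover \<open>S\<close> efficiently by disjoint intervals on which \<open>V\<close> grows by at most \<open>a\<close> times the length.
  Inside each of them, \<open>covered_superadditive\<close> bounds the outer measure of \<open>S\<close> by the increment
  of \<open>V\<close> divided by \<open>b\<close>, hence by \<open>a/b\<close> times the length.\<close>

lemma negligible_diff_quotient_oscillates:
  fixes V :: "real \<Rightarrow> real"
  assumes mono: "\<And>a b. \<alpha> \<le> a \<Longrightarrow> a \<le> b \<Longrightarrow> b \<le> \<beta> \<Longrightarrow> V a \<le> V b"
    and ab: "0 < a" "a < b" "\<alpha> \<le> \<beta>"
    and sub: "S \<subseteq> {\<alpha><..<\<beta>}"
    and lower: "\<And>x d. x \<in> S \<Longrightarrow> 0 < d \<Longrightarrow>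
          \<exists>l r. l < r \<and> l \<le> x \<and> x \<le> r \<and> r - l < d \<and> V r - V l \<le> a * (r - l)"
    and upper: "\<And>x d. x \<in> S \<Longrightarrow> 0 < d \<Longrightarrow>
          \<exists>l r. l < r \<and> l \<le> x \<and> x \<le> r \<and> r - l < d \<and> V r - V l \<ge> b * (r - l)"
  shows "negligible S"
proof -
  have b0: "b > 0" using ab by linarith
  have shrink: "covered S (a / b * (c + \<delta>))" if c: "covered S c" and "\<delta> > 0" for c \<delta>
  proof -
    obtain E where E: "E \<in> lmeasurable" "S \<subseteq> E" "measure lebesgue E \<le> c"
      using c unfolding covered_def by blast
    obtain G where G: "open G" "E \<subseteq> G" "G - E \<in> lmeasurable" "emeasure lebesgue (G - E) < ennreal \<delta>"
      using sets_lebesgue_outer_open[of E \<delta>] E \<open>\<delta> > 0\<close> by (auto simp: fmeasurableD)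
    have Gm: "G \<in> lmeasurable"
      using fmeasurable.Un[OF E(1) G(3)] G(2) by (simp add: Un_absorb1)
    have "measure lebesgue (G - E) \<le> \<delta>"
      using G(3,4) \<open>\<delta> > 0\<close> by (metis emeasure_eq_measure2 ennreal_less_iff less_eq_real_def measure_nonneg)
    moreover have "measure lebesgue (G - E) = measure lebesgue G - measure lebesgue E"
      using measurable_measure_Diff[OF Gm fmeasurableD[OF E(1)] G(2)] .
    ultimately have Gc: "measure lebesgue G \<le> c + \<delta>" using E(3) by linarith
    let ?K = "{(l, r). l < r \<and> {l..r} \<subseteq> G \<and> \<alpha> \<le> l \<and> r \<le> \<beta> \<and> V r - V l \<le> a * (r - l)}"
    have "\<exists>l r. (l, r) \<in> ?K \<and> l \<le> x \<and> x \<le> r \<and> r - l < d" if "x \<in> S" "0 < d" for x d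
    proof -
      have "x \<in> G" using that E G by auto
      then obtain \<eta> where \<eta>: "\<eta> > 0" "ball x \<eta> \<subseteq> G" using \<open>open G\<close> openE by blast
      have "0 < min (min d \<eta>) (min (x - \<alpha>) (\<beta> - x))" using sub that \<eta> by auto
      from lower[OF that(1) this] obtain l r where lr: "l < r" "l \<le> x" "x \<le> r"
        "r - l < min (min d \<eta>) (min (x - \<alpha>) (\<beta> - x))" "V r - V l \<le> a * (r - l)" by blast
      have "{l..r} \<subseteq> ball x \<eta>" using lr by (auto simp: dist_real_def)
      then show ?thesis using lr \<eta> by (intro exI[of _ l] exI[of _ r]) auto
    qed
    from Vitali_intervals[of ?K, OF _ this]
    obtain C where C: "countable C" "C \<subseteq> ?K"
      "pairwise (\<lambda>i j. disjnt {fst i..snd i} {fst j..snd j}) C"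
      "negligible (S - (\<Union>i\<in>C. {fst i..snd i}))"
      by auto
    have "covered (\<Union>i\<in>C. S \<inter> {fst i<..<snd i}) (a / b * (c + \<delta>))"
    proof (rule covered_UN[OF C(1)])
      fix i assume "i \<in> C"
      then have i: "fst i < snd i" "\<alpha> \<le> fst i" "snd i \<le> \<beta>"
          "V (snd i) - V (fst i) \<le> a * (snd i - fst i)"
        using C(2) by auto
      have "covered (S \<inter> {fst i<..<snd i}) ((V (snd i) - V (fst i)) / b)"
        by (rule covered_superadditive[where \<sigma> = "\<lambda>l r. V r - V l"])
           (use i b0 upper mono in auto)
      then show "covered (S \<inter> {fst i<..<snd i}) (a / b * (snd i - fst i))"
        by (rule covered_mono) (use i b0 in \<open>auto simp: divide_right_mono\<close>)
    next
      fix F assume F: "finite F" "F \<subseteq> C"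
      have "(\<Sum>i\<in>F. snd i - fst i) = (\<Sum>i\<in>F. measure lebesgue {fst i..snd i})"
        using F C(2) by (intro sum.cong) auto
      also have "\<dots> = measure lebesgue (\<Union>i\<in>F. {fst i..snd i})"
      proof (rule measure_UNION'[symmetric])
        show "pairwise (\<lambda>i j. disjnt {fst i..snd i} {fst j..snd j}) F"
          using pairwise_subset[OF C(3) F(2)] .
      qed (use F in auto)
      also have "\<dots> \<le> measure lebesgue G"
        using F C(2) Gm by (intro measure_mono_fmeasurable) (fastforce simp: fmeasurableD)+
      finally have "(\<Sum>i\<in>F. snd i - fst i) \<le> c + \<delta>" using Gc by linarith
      then show "(\<Sum>i\<in>F. a / b * (snd i - fst i)) \<le> a / b * (c + \<delta>)"
        unfolding sum_distrib_left[symmetric] using ab b0 by (intro mult_left_mono) auto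
    qed
    moreover have "negligible (\<Union>i\<in>C. {fst i, snd i})"
      using C(1) countable_imp_null_set_lborel[of "\<Union>i\<in>C. {fst i, snd i}"]
      by (auto simp: negligible_iff_null_sets intro: null_sets_completionI)
    ultimately have "covered ((\<Union>i\<in>C. S \<inter> {fst i<..<snd i}) \<union> (\<Union>i\<in>C. {fst i, snd i})
        \<union> (S - (\<Union>i\<in>C. {fst i..snd i}))) (a / b * (c + \<delta>) + 0 + 0)"
      using C(4) by (intro covered_Un covered_negligible)
    then show ?thesis by (rule covered_mono) force+
  qed
  \<comment> \<open>The outer measure is bounded by \<open>a/b < 1\<close> times itself.\<close>
  define M where "M = Inf {c. covered S c}"
  have cS: "covered S (\<beta> - \<alpha>)"
    using covered_interval[OF ab(3)] sub by (rule covered_mono) auto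
  have bdd: "bdd_below {c. covered S c}" using covered_nonneg by (meson bdd_belowI mem_Collect_eq)
  have M0: "M \<ge> 0" unfolding M_def using cS covered_nonneg by (intro cInf_greatest) auto
  have near: "covered S (M + e)" if "e > 0" for e
  proof -
    have "\<exists>c\<in>{c. covered S c}. c < M + e"
      using that cS unfolding M_def by (subst cInf_less_iff[OF _ bdd, symmetric]) auto
    then show ?thesis using covered_mono by (metis mem_Collect_eq order_less_imp_le order_refl)
  qed
  have "M \<le> a / b * M"
  proof (rule field_le_epsilon)
    fix e :: real assume "e > 0"
    have "M \<le> a / b * ((M + e / 2) + e / 2)"
      unfolding M_def[symmetric]
      using cInf_lower[OF _ bdd, of "a / b * ((M + e / 2) + e / 2)"] shrink[OF near[of "e/2"], of "e/2"] \<open>e > 0\<close>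
      by (auto simp: M_def)
    also have "\<dots> \<le> a / b * M + e"
      using ab b0 \<open>e > 0\<close> mult_right_mono[of "a/b" 1 e] by (simp add: distrib_left)
    finally show "M \<le> a / b * M + e" .
  qed
  then have "M * (b - a) \<le> 0" using b0 by (simp add: field_simps)
  then have "M = 0" using M0 ab by (simp add: mult_le_0_iff)
  then show ?thesis using near by (intro negligible_if_covered) auto
qed

text \<open>The difference quotient is symmetric in its two points, so the interval may lie on either side of \<open>x\<close>.\<close>

lemma frequently_diff_quotientE:
  fixes V :: "real \<Rightarrow> real"
  assumes "\<exists>\<^sub>F s in at x. R ((V s - V x) / (s - x))" "d > 0"
  obtains l r where "l < r" "l \<le> x" "x \<le> r" "r - l < d" "R ((V r - V l) / (r - l))"
proof -
  have "\<exists>\<^sub>F s in at x. R ((V s - V x) / (s - x)) \<and> (s \<noteq> x \<and> dist s x < d)"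
    by (rule frequently_rev_mp[OF assms(1)])
       (use assms(2) in \<open>auto simp: eventually_at intro!: exI[of _ d]\<close>)
  then obtain s where s: "R ((V s - V x) / (s - x))" "s \<noteq> x" "\<bar>s - x\<bar> < d"
    by (auto dest: frequently_ex simp: dist_real_def)
  show ?thesis
  proof (cases "x < s")
    case True
    then show ?thesis using s by (intro that[of x s]) auto
  next
    case False
    have "(V x - V s) / (x - s) = (V s - V x) / (s - x)"
      by (metis minus_diff_eq minus_divide_divide)
    then show ?thesis using False s by (intro that[of s x]) auto
  qed
qed

text \<open>Where the difference quotient of \<open>V\<close> has no finite limit, it oscillates across two rational levels or is
  unbounded.  The first case is \<open>negligible_diff_quotient_oscillates\<close>; in the second one,
  \<open>covered_superadditive\<close> applies with arbitrarily large slopes.\<close>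

theorem mono_differentiable_ae:
  fixes V :: "real \<Rightarrow> real"
  assumes mono: "\<And>a b. \<alpha> \<le> a \<Longrightarrow> a \<le> b \<Longrightarrow> b \<le> \<beta> \<Longrightarrow> V a \<le> V b" and ab: "\<alpha> \<le> \<beta>"
  shows "negligible {x\<in>{\<alpha><..<\<beta>}. \<nexists>L. (V has_real_derivative L) (at x)}"
proof -
  define Q where "Q x s = (V s - V x) / (s - x)" for x s
  define S where "S = (\<lambda>(a, b). {x\<in>{\<alpha><..<\<beta>}. (\<exists>\<^sub>F s in at x. Q x s \<le> a) \<and> (\<exists>\<^sub>F s in at x. Q x s \<ge> b)})"
  define S' where "S' = {x\<in>{\<alpha><..<\<beta>}. \<forall>b. \<exists>\<^sub>F s in at x. Q x s \<ge> b}"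
  have frq: "\<exists>l r. l < r \<and> l \<le> x \<and> x \<le> r \<and> r - l < d \<and> R ((V r - V l) / (r - l))"
    if "\<exists>\<^sub>F s in at x. R (Q x s)" "0 < d" for R x d
    using frequently_diff_quotientE[of R V x d] that unfolding Q_def by metis
  have neg: "negligible (S (a, b))" if "0 < a" "a < b" for a b
  proof (rule negligible_diff_quotient_oscillates[of \<alpha> \<beta> V a b])
    fix x d :: real assume x: "x \<in> S (a, b)" "0 < d"
    show "\<exists>l r. l < r \<and> l \<le> x \<and> x \<le> r \<and> r - l < d \<and> V r - V l \<le> a * (r - l)"
    proof -
      obtain l r where "l < r" "l \<le> x" "x \<le> r" "r - l < d" "(V r - V l) / (r - l) \<le> a"
        using frq[of "\<lambda>z. z \<le> a" x d] x by (auto simp: S_def)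
      then show ?thesis by (intro exI[of _ l] exI[of _ r]) (simp add: field_simps)
    qed
    show "\<exists>l r. l < r \<and> l \<le> x \<and> x \<le> r \<and> r - l < d \<and> b * (r - l) \<le> V r - V l"
    proof -
      obtain l r where "l < r" "l \<le> x" "x \<le> r" "r - l < d" "(V r - V l) / (r - l) \<ge> b"
        using frq[of "\<lambda>z. z \<ge> b" x d] x by (auto simp: S_def)
      then show ?thesis by (intro exI[of _ l] exI[of _ r]) (simp add: field_simps)
    qed
  qed (use that mono ab in \<open>auto simp: S_def\<close>)
  have neg': "negligible S'"
  proof (rule negligible_if_covered)
    fix e :: real assume "e > 0"
    \<comment> \<open>Any slope of at least \<open>(V \<beta> - V \<alpha>) / e\<close> would do; the summand \<open>1\<close> keeps it positive.\<close>
    define b where "b = (V \<beta> - V \<alpha> + 1) / e"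
    have V: "V \<alpha> \<le> V \<beta>" using mono ab by auto
    then have b: "b > 0" using \<open>e > 0\<close> by (auto simp: b_def)
    have "covered S' ((V \<beta> - V \<alpha>) / b)"
    proof (rule covered_superadditive[where \<sigma> = "\<lambda>l r. V r - V l", OF ab b])
      fix x d :: real assume x: "x \<in> S'" "0 < d"
      show "\<exists>l r. l < r \<and> l \<le> x \<and> x \<le> r \<and> r - l < d \<and> b * (r - l) \<le> V r - V l"
      proof -
        obtain l r where "l < r" "l \<le> x" "x \<le> r" "r - l < d" "(V r - V l) / (r - l) \<ge> b"
          using frq[of "\<lambda>z. z \<ge> b" x d] x by (auto simp: S'_def)
        then show ?thesis by (intro exI[of _ l] exI[of _ r]) (simp add: field_simps)
      qed
    qed (auto simp: S'_def mono)
    moreover have "(V \<beta> - V \<alpha>) / b \<le> e" using V \<open>e > 0\<close> by (simp add: b_def field_simps)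
    ultimately show "covered S' e" by (rule covered_mono[OF _ order_refl])
  qed
  define I where "I = {(a, b). a \<in> \<rat> \<and> b \<in> \<rat> \<and> 0 < a \<and> a < (b::real)}"
  have "countable I"
    by (rule countable_subset[of _ "\<rat> \<times> \<rat>"]) (auto simp: I_def countable_rat)
  then have "negligible (\<Union>(S ` I))"
    using neg by (intro negligible_countable_Union) (auto simp: I_def)
  then have "negligible (\<Union>(S ` I) \<union> S')" using neg' by simp
  moreover have "\<exists>L. (V has_real_derivative L) (at x)"
    if x: "x \<in> {\<alpha><..<\<beta>}" "x \<notin> \<Union>(S ` I)" "x \<notin> S'" for x
  proof -
    define i where "i = Liminf (at x) (\<lambda>s. ereal (Q x s))"
    define j where "j = Limsup (at x) (\<lambda>s. ereal (Q x s))"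
    have "\<forall>\<^sub>F s in at x. s \<in> {\<alpha><..<\<beta>}"
      using x by (intro eventually_at_in_open') auto
    then have "\<forall>\<^sub>F s in at x. 0 \<le> Q x s"
    proof eventually_elim
      case (elim s)
      then show ?case using mono[of x s] mono[of s x] x
        by (cases "x \<le> s") (auto simp: Q_def zero_le_divide_iff)
    qed
    then have i0: "0 \<le> i" unfolding i_def
      by (intro Liminf_bounded) (auto elim: eventually_mono)
    obtain b where "\<forall>\<^sub>F s in at x. Q x s < b"
      using x unfolding S'_def by (auto simp: frequently_def not_le)
    then have jb: "j \<le> ereal b" unfolding j_def
      by (intro Limsup_bounded) (auto elim!: eventually_mono)
    have ij: "i \<le> j" unfolding i_def j_def by (intro Liminf_le_Limsup) simp
    have "i = j"
    proof (rule ccontr)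
      assume "i \<noteq> j"
      then have "i < j" using ij by simp
      obtain i' j' where r: "i = ereal i'" "j = ereal j'"
        using i0 ij jb by (cases i; cases j) auto
      obtain a where a: "a \<in> \<rat>" "i' < a" "a < j'" using Rats_dense_in_real \<open>i < j\<close> r by auto
      obtain c where c: "c \<in> \<rat>" "a < c" "c < j'" using Rats_dense_in_real a by blast
      have "(a, c) \<in> I" using a c i0 r by (auto simp: I_def)
      moreover have "\<exists>\<^sub>F s in at x. Q x s \<le> a"
      proof (rule ccontr)
        assume "\<not> ?thesis"
        then have "ereal a \<le> i" unfolding i_def
          by (intro Liminf_bounded) (auto simp: frequently_def not_le elim!: eventually_mono)
        then show False using a r by simp
      qed
      moreover have "\<exists>\<^sub>F s in at x. Q x s \<ge> c"
      proof (rule ccontr)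
        assume "\<not> ?thesis"
        then have "j \<le> ereal c" unfolding j_def
          by (intro Limsup_bounded) (auto simp: frequently_def not_le elim!: eventually_mono)
        then show False using c r by simp
      qed
      ultimately show False using x by (auto simp: S_def)
    qed
    moreover obtain L where "i = ereal L" using i0 ij jb by (cases i; cases j) auto
    ultimately have "((\<lambda>s. ereal (Q x s)) \<longlongrightarrow> ereal L) (at x)"
      by (intro Liminf_eq_Limsup) (auto simp: i_def j_def)
    then show ?thesis unfolding has_field_derivative_iff Q_def by auto
  qed
  ultimately show ?thesis
    by (elim negligible_subset) blast
qed

text \<open>Here \<open>ac\<close> says that \<open>V\<close> is absolutely continuous: its increments are dominated by a large
  multiple of the length plus a small multiple of those of the bounded monotone function \<open>E\<close>.
  The gauge integral then needs no convergence theorem.  Tags outside \<open>N\<close> are handled by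
  differentiability.  The intervals tagged in \<open>N\<close> lie in an open set \<open>G\<close> of small measure, and
  \<open>V\<close> has a small total increment over them.\<close>

theorem has_integral_derivative_ae:
  fixes V E f :: "real \<Rightarrow> real"
  assumes ab: "\<alpha> \<le> \<beta>"
    and mono: "\<And>a b. \<alpha> \<le> a \<Longrightarrow> a \<le> b \<Longrightarrow> b \<le> \<beta> \<Longrightarrow> V a \<le> V b"
    and monoE: "\<And>a b. \<alpha> \<le> a \<Longrightarrow> a \<le> b \<Longrightarrow> b \<le> \<beta> \<Longrightarrow> E a \<le> E b"
    and ac: "\<And>\<eta>. \<eta> > 0 \<Longrightarrow> \<exists>C. \<forall>s t. \<alpha> \<le> s \<longrightarrow> s \<le> t \<longrightarrow> t \<le> \<beta> \<longrightarrow> V t - V s \<le> C * (t - s) + \<eta> * (E t - E s)"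
    and N: "negligible N"
    and deriv: "\<And>x. x \<in> {\<alpha>..\<beta>} - N \<Longrightarrow> (V has_real_derivative f x) (at x within {\<alpha>..\<beta>})"
  shows "(f has_integral (V \<beta> - V \<alpha>)) {\<alpha>..\<beta>}"
proof -
  define h where "h x = (if x \<in> N then 0 else f x)" for x
  have "(h has_integral (V \<beta> - V \<alpha>)) {\<alpha>..\<beta>}"
    unfolding has_integral_real
  proof (intro allI impI)
    fix e :: real assume e: "e > 0"
    define \<eta> where "\<eta> = e / (4 * (E \<beta> - E \<alpha> + 1))"
    define \<kappa> where "\<kappa> = e / (4 * (\<beta> - \<alpha> + 1))"
    have E0: "E \<beta> - E \<alpha> \<ge> 0" using monoE ab by simp
    have \<eta>: "\<eta> > 0" "\<eta> * (E \<beta> - E \<alpha>) \<le> e / 4" using e E0 by (auto simp: \<eta>_def field_simps)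
    have \<kappa>: "\<kappa> > 0" "\<kappa> * (\<beta> - \<alpha>) \<le> e / 4" using e ab by (auto simp: \<kappa>_def field_simps)
    obtain C0 where C0: "\<And>s t. \<alpha> \<le> s \<Longrightarrow> s \<le> t \<Longrightarrow> t \<le> \<beta> \<Longrightarrow> V t - V s \<le> C0 * (t - s) + \<eta> * (E t - E s)"
      using ac[OF \<eta>(1)] by blast
    define C where "C = max C0 1"
    have C: "V t - V s \<le> C * (t - s) + \<eta> * (E t - E s)" if "\<alpha> \<le> s" "s \<le> t" "t \<le> \<beta>" for s t
      using C0[OF that] mult_right_mono[of C0 C "t - s"] that by (auto simp: C_def)
    have C1: "C \<ge> 1" by (simp add: C_def)
    obtain G where G: "open G" "N \<subseteq> G" "G \<in> lmeasurable" "measure lebesgue G \<le> e / (4 * C)"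
    proof -
      have Nl: "N \<in> sets lebesgue" "measure lebesgue N = 0" "N \<in> lmeasurable"
        using N by (auto simp: negligible_iff_measure fmeasurableD)
      have ec: "e / (4 * C) > 0" using e C1 by simp
      from sets_lebesgue_outer_open[OF Nl(1) ec] obtain G where G: "open G" "N \<subseteq> G" "G - N \<in> lmeasurable"
        "emeasure lebesgue (G - N) < ennreal (e / (4 * C))" by blast
      have Gm: "G \<in> lmeasurable"
        using fmeasurable.Un[OF Nl(3) G(3)] G(2) by (simp add: Un_absorb1)
      have "measure lebesgue (G - N) \<le> e / (4 * C)"
        using G(3,4) ec by (metis emeasure_eq_measure2 ennreal_less_iff less_eq_real_def measure_nonneg)
      moreover have "measure lebesgue (G - N) = measure lebesgue G"
        using measurable_measure_Diff[OF Gm Nl(1) G(2)] Nl by simp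
      ultimately show ?thesis using that G Gm by auto
    qed
    \<comment> \<open>The measure of \<open>G\<close> as a telescoping sum: \<open>W\<close> grows at unit rate inside \<open>G\<close>.\<close>
    define W where "W t = measure lebesgue (G \<inter> {\<alpha>..t})" for t
    have Wm: "G \<inter> {\<alpha>..t} \<in> lmeasurable" for t using G(3) by auto
    have Wmono: "W s \<le> W t" if "s \<le> t" for s t
      unfolding W_def using that Wm by (intro measure_mono_fmeasurable) (auto simp: fmeasurableD)
    have WG: "W s + (t - s) \<le> W t" if "\<alpha> \<le> s" "s \<le> t" "{s..t} \<subseteq> G" for s t
    proof -
      have "W s + (t - s) = measure lebesgue (G \<inter> {\<alpha>..s}) + measure lebesgue {s<..t}"
        using that by (simp add: W_def)
      also have "\<dots> = measure lebesgue ((G \<inter> {\<alpha>..s}) \<union> {s<..t})"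
        using Wm by (intro measure_Un_AE[symmetric]) (auto intro: bounded_set_imp_lmeasurable)
      also have "\<dots> \<le> W t"
        unfolding W_def using that Wm by (intro measure_mono_fmeasurable) (auto simp: fmeasurableD)
      finally show ?thesis .
    qed
    have W\<beta>: "W \<beta> - W \<alpha> \<le> e / (4 * C)"
    proof -
      have "W \<beta> \<le> measure lebesgue G"
        unfolding W_def using G Wm by (intro measure_mono_fmeasurable) (auto simp: fmeasurableD)
      moreover have "W \<alpha> \<ge> 0" by (simp add: W_def)
      ultimately show ?thesis using G(4) by linarith
    qed
    have "\<exists>d>0. \<forall>y\<in>{\<alpha>..\<beta>}. \<bar>y - x\<bar> < d \<longrightarrow> \<bar>V y - V x - f x * (y - x)\<bar> \<le> \<kappa> * \<bar>y - x\<bar>"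
      if "x \<in> {\<alpha>..\<beta>} - N" for x
      using deriv[OF that] \<kappa>(1)
      unfolding has_field_derivative_def has_derivative_within_alt real_norm_def by blast
    then obtain d where d: "\<And>x. x \<in> {\<alpha>..\<beta>} - N \<Longrightarrow> d x > 0"
      "\<And>x y. x \<in> {\<alpha>..\<beta>} - N \<Longrightarrow> y \<in> {\<alpha>..\<beta>} \<Longrightarrow> \<bar>y - x\<bar> < d x \<Longrightarrow>
          \<bar>V y - V x - f x * (y - x)\<bar> \<le> \<kappa> * \<bar>y - x\<bar>"
      by metis
    define \<gamma> where "\<gamma> x = (if x \<in> N then G else if x \<in> {\<alpha>..\<beta>} then ball x (d x) else UNIV)" for x
    have "gauge \<gamma>" unfolding gauge_def \<gamma>_def using G d by auto
    moreover have "norm ((\<Sum>(x, k)\<in>\<D>. measure lborel k *\<^sub>R h x) - (V \<beta> - V \<alpha>)) < e"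
      if D: "\<D> tagged_division_of {\<alpha>..\<beta>}" "\<gamma> fine \<D>" for \<D>
    proof -
      \<comment> \<open>The three sources of error as increments of one function, so that their sum telescopes.\<close>
      define Z where "Z t = \<kappa> * t + C * W t + \<eta> * E t" for t
      note tele = additive_tagged_division_1[OF ab D(1)]
      have tagged: "\<bar>measure lborel k *\<^sub>R h x - (V (Sup k) - V (Inf k))\<bar> \<le> Z (Sup k) - Z (Inf k)"
        if xk: "(x, k) \<in> \<D>" for x k
      proof -
        obtain l r where k: "k = {l..r}" "l \<le> r" "x \<in> k" "k \<subseteq> {\<alpha>..\<beta>}" "k \<subseteq> \<gamma> x"
        proof -
          have "x \<in> k" "k \<subseteq> {\<alpha>..\<beta>}" "k \<subseteq> \<gamma> x"
            using tagged_division_ofD(2,3)[OF D(1) xk] fineD[OF D(2) xk] by auto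
          moreover obtain l r where "k = cbox l r" using tagged_division_ofD(4)[OF D(1) xk] by blast
          ultimately show ?thesis using that[of l r] by auto
        qed
        have lr: "\<alpha> \<le> l" "l \<le> x" "x \<le> r" "r \<le> \<beta>" using k by auto
        have Zlr: "Z r - Z l = \<kappa> * (r - l) + C * (W r - W l) + \<eta> * (E r - E l)"
          by (simp add: Z_def algebra_simps)
        have nn: "C * (W r - W l) \<ge> 0" "\<eta> * (E r - E l) \<ge> 0" "\<kappa> * (r - l) \<ge> 0"
          using C1 \<eta> \<kappa> Wmono monoE lr k(2) by auto
        show ?thesis
        proof (cases "x \<in> N")
          case True
          then have "W l + (r - l) \<le> W r" using WG[of l r] lr k by (auto simp: \<gamma>_def)
          then have "C * (r - l) \<le> C * (W r - W l)" using C1 by (intro mult_left_mono) auto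
          then show ?thesis
            using C[of l r] mono[of l r] lr nn True k(1,2) Zlr by (auto simp: h_def)
        next
          case False
          then have x: "x \<in> {\<alpha>..\<beta>} - N" using lr by auto
          have "l \<in> \<gamma> x" "r \<in> \<gamma> x" using k by auto
          then have "\<bar>l - x\<bar> < d x" "\<bar>r - x\<bar> < d x"
            using x by (auto simp: \<gamma>_def dist_real_def abs_minus_commute)
          then have "\<bar>V l - V x - f x * (l - x)\<bar> \<le> \<kappa> * (x - l)" "\<bar>V r - V x - f x * (r - x)\<bar> \<le> \<kappa> * (r - x)"
            using d(2)[OF x, of l] d(2)[OF x, of r] lr by auto
          then have "\<bar>f x * (r - l) - (V r - V l)\<bar> \<le> \<kappa> * (r - l)"
            by (simp add: algebra_simps abs_le_iff)
          then show ?thesis using nn Zlr False k(1,2) by (simp add: h_def mult.commute)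
        qed
      qed
      have "norm ((\<Sum>(x, k)\<in>\<D>. measure lborel k *\<^sub>R h x) - (V \<beta> - V \<alpha>))
          = norm (\<Sum>(x, k)\<in>\<D>. measure lborel k *\<^sub>R h x - (V (Sup k) - V (Inf k)))"
        using tele[of V] by (simp add: sum_subtractf case_prod_beta')
      also have "\<dots> \<le> (\<Sum>(x, k)\<in>\<D>. Z (Sup k) - Z (Inf k))"
        using tagged by (intro sum_norm_le) auto
      also have "\<dots> = Z \<beta> - Z \<alpha>" by (rule tele)
      also have "\<dots> = \<kappa> * (\<beta> - \<alpha>) + C * (W \<beta> - W \<alpha>) + \<eta> * (E \<beta> - E \<alpha>)"
        by (simp add: Z_def algebra_simps)
      also have "C * (W \<beta> - W \<alpha>) \<le> C * (e / (4 * C))"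
        using W\<beta> C1 by (intro mult_left_mono) auto
      also have "C * (e / (4 * C)) = e / 4" using C1 by simp
      finally show ?thesis using \<eta> \<kappa> e by linarith
    qed
    ultimately show "\<exists>\<gamma>. gauge \<gamma> \<and> (\<forall>\<D>. \<D> tagged_division_of {\<alpha>..\<beta>} \<and> \<gamma> fine \<D> \<longrightarrow>
        norm ((\<Sum>(x, k)\<in>\<D>. measure lborel k *\<^sub>R h x) - (V \<beta> - V \<alpha>)) < e)"
      by (intro exI[of _ \<gamma>] conjI allI impI) simp_all
  qed
  then show ?thesis
    using has_integral_spike[OF N, of "{\<alpha>..\<beta>}" f h] by (auto simp: h_def)
qed

section \<open>Arc length and the metric derivative\<close>

text \<open>\<open>inscribed u a t l\<close>: some polygon inscribed in \<open>u\<close> from time \<open>a\<close> to time \<open>t\<close> has length \<open>l\<close>.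
  Induction over the polygon replaces manipulations of partitions.\<close>

inductive inscribed :: "(real \<Rightarrow> 'a::metric_space) \<Rightarrow> real \<Rightarrow> real \<Rightarrow> real \<Rightarrow> bool" for u a where
  base: "inscribed u a a 0"
| step: "inscribed u a s l \<Longrightarrow> s \<le> t \<Longrightarrow> inscribed u a t (l + dist (u s) (u t))"

definition arc_length :: "(real \<Rightarrow> 'a::metric_space) \<Rightarrow> real \<Rightarrow> real \<Rightarrow> real" where
  "arc_length u a t = Sup {l. inscribed u a t l}"

lemma inscribed_exists: "a \<le> t \<Longrightarrow> \<exists>l. inscribed u a t l"
  using inscribed.base inscribed.step by blast

lemma inscribed_le:
  assumes "inscribed u a t l" and "t \<le> b"
    and B: "\<And>s t. a \<le> s \<Longrightarrow> s \<le> t \<Longrightarrow> t \<le> b \<Longrightarrow> dist (u s) (u t) \<le> B t - B s"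
  shows "a \<le> t" "l \<le> B t - B a"
  using assms
proof (induction)
  case (step s l t)
  { case 1 then show ?case using step by auto }
  { case 2 then show ?case using step B[of s t] by force }
qed auto

context
  fixes u :: "real \<Rightarrow> 'a::metric_space" and a b :: real and B :: "real \<Rightarrow> real"
  assumes B: "\<And>s t. a \<le> s \<Longrightarrow> s \<le> t \<Longrightarrow> t \<le> b \<Longrightarrow> dist (u s) (u t) \<le> B t - B s"
begin

lemma inscribed_le_arc_length: "inscribed u a t l \<Longrightarrow> t \<le> b \<Longrightarrow> l \<le> arc_length u a t"
  unfolding arc_length_def using inscribed_le(2)[of u a t _ b B] B
  by (intro cSup_upper bdd_aboveI[of _ "B t - B a"]) auto

lemma arc_length_step:
  assumes "a \<le> s" "s \<le> t" "t \<le> b"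
  shows "arc_length u a s + dist (u s) (u t) \<le> arc_length u a t"
proof -
  have "arc_length u a s \<le> arc_length u a t - dist (u s) (u t)"
    unfolding arc_length_def[of u a s]
  proof (rule cSup_least)
    fix l assume "l \<in> {l. inscribed u a s l}"
    then show "l \<le> arc_length u a t - dist (u s) (u t)"
      using inscribed_le_arc_length[of t "l + dist (u s) (u t)"] assms inscribed.step by force
  qed (use inscribed_exists assms in auto)
  then show ?thesis by simp
qed

text \<open>A polygon from \<open>a\<close> to \<open>t\<close> is cut at time \<open>s\<close>: the part before \<open>s\<close> is completed to a polygon ending at \<open>s\<close>,
  and \<open>B\<close> bounds the rest.\<close>

lemma arc_length_diff_le:
  assumes "a \<le> s" "s \<le> t" "t \<le> b"
  shows "arc_length u a t - arc_length u a s \<le> B t - B s"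
proof -
  have "l \<le> arc_length u a s + (B t - B s)" if "inscribed u a t l" "s \<le> t" "t \<le> b" for t l
    using that
  proof (induction)
    case base
    then show ?case
      using \<open>a \<le> s\<close> inscribed_le_arc_length[OF inscribed.base] by auto
  next
    case (step r l t)
    have r: "a \<le> r" using inscribed_le(1)[OF step.hyps(1), of b B] B step by auto
    show ?case
    proof (cases "s \<le> r")
      case True
      then show ?thesis using step B[of r t] r by force
    next
      case False
      then have "l + dist (u r) (u s) \<le> arc_length u a s"
        using step assms by (intro inscribed_le_arc_length inscribed.step) auto
      then show ?thesis using dist_triangle[of "u r" "u t" "u s"] B[of s t] step assms by auto
    qed
  qed
  then have "arc_length u a t \<le> arc_length u a s + (B t - B s)"
    unfolding arc_length_def[of u a t] using assms inscribed_exists[of a t u] by (intro cSup_least) auto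
  then show ?thesis by simp
qed

text \<open>The points that lie in arbitrarily short time intervals over which arc length exceeds distance
  by a fixed fraction of the time elapsed.\<close>

definition length_defect :: "real \<Rightarrow> real set" where
  "length_defect e = {x. \<forall>d>0. \<exists>l r. l < r \<and> l \<le> x \<and> x \<le> r \<and> r - l < d \<and>
       arc_length u a r - arc_length u a l - dist (u l) (u r) \<ge> e * (r - l)}"

text \<open>By the triangle inequality the excess of arc length over distance is superadditive.  Over the
  edges of an inscribed polygon of length \<open>l\<close> it adds up to \<open>arc_length u a t - l\<close>, which is small for a good polygon.\<close>

lemma covered_length_defect:
  assumes "inscribed u a t l" "t \<le> b" "e > 0"
  shows "covered (length_defect e \<inter> {a<..<t}) ((arc_length u a t - l) / e)"
  using assms(1,2)
proof (induction)
  case base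
  have "0 \<le> arc_length u a a" using inscribed_le_arc_length[OF inscribed.base] base by simp
  then show ?case
    using \<open>e > 0\<close> by (intro covered_mono[OF covered_negligible[OF negligible_empty]]) auto
next
  case (step s l t)
  have s: "a \<le> s" using inscribed_le(1)[OF step.hyps(1), of b B] B step by auto
  have "covered (length_defect e \<inter> {s<..<t})
      ((arc_length u a t - arc_length u a s - dist (u s) (u t)) / e)"
  proof (rule covered_superadditive[where \<sigma> = "\<lambda>l r. arc_length u a r - arc_length u a l - dist (u l) (u r)"])
    fix c d assume "s \<le> c" "c \<le> d" "d \<le> t"
    then show "0 \<le> arc_length u a d - arc_length u a c - dist (u c) (u d)"
      using arc_length_step[of c d] s step by auto
  next
    fix c d f show "arc_length u a d - arc_length u a c - dist (u c) (u d)
        + (arc_length u a f - arc_length u a d - dist (u d) (u f))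
      \<le> arc_length u a f - arc_length u a c - dist (u c) (u f)"
      using dist_triangle[of "u c" "u f" "u d"] by auto
  next
    fix x d assume "x \<in> length_defect e \<inter> {s<..<t}" "0 < (d::real)"
    then show "\<exists>l r. l < r \<and> l \<le> x \<and> x \<le> r \<and> r - l < d \<and>
        e * (r - l) \<le> arc_length u a r - arc_length u a l - dist (u l) (u r)"
      unfolding length_defect_def by blast
  qed (use step \<open>e > 0\<close> in auto)
  moreover have "covered (length_defect e \<inter> {a<..<s}) ((arc_length u a s - l) / e)"
    using step by auto
  ultimately have "covered (length_defect e \<inter> {a<..<s} \<union> length_defect e \<inter> {s<..<t} \<union> {s})
    ((arc_length u a s - l) / e + (arc_length u a t - arc_length u a s - dist (u s) (u t)) / e + 0)"
    by (intro covered_Un covered_negligible) auto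
  then show ?case
    by (rule covered_mono) (auto simp: diff_divide_distrib add_divide_distrib)
qed

lemma negligible_length_defect:
  assumes "a \<le> b" "e > 0"
  shows "negligible (length_defect e \<inter> {a<..<b})"
proof (rule negligible_if_covered)
  fix d :: real assume "d > 0"
  have "arc_length u a b - d * e < Sup {l. inscribed u a b l}"
    using \<open>d > 0\<close> \<open>e > 0\<close> by (simp add: arc_length_def)
  then obtain l where l: "inscribed u a b l" "arc_length u a b - d * e < l"
    using less_cSupD[of "{l. inscribed u a b l}"] inscribed_exists[OF \<open>a \<le> b\<close>] that by blast
  have "covered (length_defect e \<inter> {a<..<b}) ((arc_length u a b - l) / e)"
    using covered_length_defect[OF l(1) order_refl \<open>e > 0\<close>] .
  then show "covered (length_defect e \<inter> {a<..<b}) d"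
    by (rule covered_mono) (use l \<open>e > 0\<close> in \<open>auto simp: field_simps\<close>)
qed

text \<open>Arc length is monotone and hence differentiable almost everywhere, and outside the
  length defects the quotients of distance and of arc length have the same limit.\<close>

theorem metric_derivative_ae:
  assumes ab: "a \<le> b"
  shows "negligible {x\<in>{a<..<b}. \<nexists>L. ((\<lambda>s. dist (u s) (u x) / \<bar>x - s\<bar>) \<longlongrightarrow> L) (at x)
             \<and> (arc_length u a has_real_derivative L) (at x)}"
    (is "negligible ?S")
proof -
  have mono: "arc_length u a s \<le> arc_length u a t" if "a \<le> s" "s \<le> t" "t \<le> b" for s t
    using arc_length_step[OF that] by (meson add_increasing2 dist_triangle_le le_add_same_cancel1 order_trans zero_le_dist)
  have "negligible (\<Union>n. length_defect (1 / Suc n) \<inter> {a<..<b})"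
    using negligible_length_defect[OF ab] by (intro negligible_Union_nat) auto
  then have "negligible ({x\<in>{a<..<b}. \<nexists>L. (arc_length u a has_real_derivative L) (at x)}
      \<union> (\<Union>n. length_defect (1 / Suc n) \<inter> {a<..<b}))" (is "negligible ?N")
    using mono_differentiable_ae[OF mono ab] by simp
  moreover have "?S \<subseteq> ?N"
  proof (rule ccontr)
    assume "\<not> ?S \<subseteq> ?N"
    then obtain x where x: "x \<in> {a<..<b}" "x \<in> ?S" "\<And>n. x \<notin> length_defect (1 / Suc n)"
      "\<exists>L. (arc_length u a has_real_derivative L) (at x)" by blast
    then obtain L where L: "(arc_length u a has_real_derivative L) (at x)" by blast
    have "((\<lambda>s. (arc_length u a s - arc_length u a x) / (s - x) - dist (u s) (u x) / \<bar>x - s\<bar>) \<longlongrightarrow> 0) (at x)"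
    proof (rule tendstoI)
      fix e :: real assume "e > 0"
      then obtain n where n: "1 / Suc n < e" using nat_approx_posE by auto
      obtain d where d: "d > 0" "\<And>l r. l < r \<Longrightarrow> l \<le> x \<Longrightarrow> x \<le> r \<Longrightarrow> r - l < d \<Longrightarrow>
          arc_length u a r - arc_length u a l - dist (u l) (u r) < 1 / Suc n * (r - l)"
        using x(3)[of n] unfolding length_defect_def not_all not_ex mem_Collect_eq by (metis not_le)
      define d' where "d' = min d (min (x - a) (b - x))"
      have "d' > 0" using d x by (auto simp: d'_def)
      moreover have "dist ((arc_length u a s - arc_length u a x) / (s - x) - dist (u s) (u x) / \<bar>x - s\<bar>) 0 < e"
        if s: "s \<noteq> x" "\<bar>s - x\<bar> < d'" for s
      proof -
        define l where "l = min s x"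
        define r where "r = max s x"
        have lr: "l < r" "l \<le> x" "x \<le> r" "r - l < d" "a \<le> l" "r \<le> b"
          using s by (auto simp: l_def r_def d'_def)
        have "(arc_length u a s - arc_length u a x) / (s - x) - dist (u s) (u x) / \<bar>x - s\<bar>
          = (arc_length u a r - arc_length u a l - dist (u l) (u r)) / (r - l)"
        proof (cases "s < x")
          case True
          then show ?thesis by (simp add: l_def r_def min_def max_def dist_commute divide_simps) (simp add: algebra_simps)
        next
          case False
          then show ?thesis using s by (simp add: l_def r_def min_def max_def dist_commute divide_simps)
        qed
        moreover have "0 \<le> arc_length u a r - arc_length u a l - dist (u l) (u r)"
          using arc_length_step[of l r] lr by simp
        moreover have "(arc_length u a r - arc_length u a l - dist (u l) (u r)) / (r - l) < 1 / Suc n"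
          using d(2)[of l r] lr by (simp add: field_simps)
        ultimately show ?thesis using n lr by (simp add: dist_real_def)
      qed
      ultimately show "\<forall>\<^sub>F s in at x. dist ((arc_length u a s - arc_length u a x) / (s - x) - dist (u s) (u x) / \<bar>x - s\<bar>) 0 < e"
        unfolding eventually_at by (intro exI[of _ d']) (auto simp: dist_real_def)
    qed
    from tendsto_diff[OF L[unfolded has_field_derivative_iff] this] L x(2) show False by auto
  qed
  ultimately show ?thesis by (rule negligible_subset)
qed

end

section \<open>Curves with a bound on their kinetic energy\<close>

text \<open>The integral of \<open>F (x + h) - F x\<close> telescopes: after a translation, only an interval of length \<open>h\<close>
  near \<open>b\<close> contributes positively.\<close>

lemma nn_integral_mono_diff_quotient_le:
  fixes F :: "real \<Rightarrow> real"
  assumes mono: "mono F" and bd: "\<And>x. 0 \<le> F x" "\<And>x. F x \<le> M" and "h > 0" "a \<le> b"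
  shows "(\<integral>\<^sup>+x\<in>{a..b}. ennreal ((F (x + h) - F x) / h) \<partial>lborel) \<le> ennreal M"
proof -
  have [measurable]: "F \<in> borel_measurable borel" using mono by (rule borel_measurable_mono)
  have M: "M \<ge> 0" using bd[of 0] by linarith
  define D where "D = (\<integral>\<^sup>+x\<in>{a..b}. ennreal ((F (x + h) - F x) / h) \<partial>lborel)"
  define I where "I = (\<integral>\<^sup>+x\<in>{a..b}. ennreal (F x) \<partial>lborel)"
  have "I \<le> (\<integral>\<^sup>+x\<in>{a..b}. ennreal M \<partial>lborel)"
    unfolding I_def using bd by (intro nn_integral_mono) (auto split: split_indicator intro: ennreal_leI)
  also have "\<dots> < \<infinity>" using \<open>a \<le> b\<close> by (simp add: nn_integral_cmult_indicator ennreal_mult_less_top)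
  finally have Ifin: "I < \<infinity>" .
  have incr: "F x \<le> F (x + h)" for x using mono \<open>h > 0\<close> by (auto simp: mono_def)
  have "I + ennreal h * D = (\<integral>\<^sup>+x. ennreal (F (x + h)) * indicator {a..b} x \<partial>lborel)"
  proof -
    have "I + ennreal h * D = (\<integral>\<^sup>+x. ennreal (F x) * indicator {a..b} x
        + ennreal h * (ennreal ((F (x + h) - F x) / h) * indicator {a..b} x) \<partial>lborel)"
      unfolding I_def D_def by (simp add: nn_integral_add nn_integral_cmult)
    also have "\<dots> = (\<integral>\<^sup>+x. ennreal (F (x + h)) * indicator {a..b} x \<partial>lborel)"
      using bd incr \<open>h > 0\<close>
      by (intro nn_integral_cong) (auto split: split_indicator simp: ennreal_mult'[symmetric] ennreal_plus[symmetric] simp del: ennreal_plus)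
    finally show ?thesis .
  qed
  also have "\<dots> = (\<integral>\<^sup>+y. ennreal (F y) * indicator {a + h..b + h} y \<partial>lborel)"
    by (subst nn_integral_real_affine[of "\<lambda>y. ennreal (F y) * indicator {a + h..b + h} y" 1 h])
       (auto intro!: nn_integral_cong split: split_indicator simp: add.commute)
  also have "\<dots> \<le> (\<integral>\<^sup>+y. ennreal (F y) * indicator {a..b} y + ennreal M * indicator {b..b + h} y \<partial>lborel)"
    using bd \<open>h > 0\<close> by (intro nn_integral_mono) (auto split: split_indicator intro: ennreal_leI)
  also have "\<dots> = I + ennreal h * ennreal M"
    using \<open>h > 0\<close> by (simp add: nn_integral_add I_def nn_integral_cmult_indicator mult.commute)
  finally have "ennreal h * D \<le> ennreal h * ennreal M"
    using Ifin by (auto simp: ennreal_add_left_cancel_le)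
  then show ?thesis
    unfolding D_def using \<open>h > 0\<close> by (simp add: ennreal_mult_le_mult_iff)
qed

text \<open>The hypothesis \<open>energy\<close> is the linearised form of
  \<open>d(u s, u t)\<^sup>p \<le> (t - s)\<^sup>p\<^sup>-\<^sup>1 (E t - E s)\<close>: the latter is recovered by choosing the best \<open>c\<close>.  Large \<open>c\<close>
  gives the absolute continuity of arc length, so the metric derivative \<open>g\<close> integrates to arc
  length.  Dividing by \<open>t - s\<close>, taking the limit at a point \<open>x\<close>, and choosing \<open>c = g x\<close>
  bounds \<open>(g x)\<^sup>p\<close> by the lower limit of the difference quotients of \<open>E\<close>, and Fatou's lemma gives the energy bound.\<close>

theorem metric_derivative_energy:
  fixes u :: "real \<Rightarrow> 'a::metric_space" and E :: "real \<Rightarrow> real" and p :: real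
  assumes p: "p > 1" and ab: "a \<le> b"
    and monoE: "\<And>s t. a \<le> s \<Longrightarrow> s \<le> t \<Longrightarrow> t \<le> b \<Longrightarrow> E s \<le> E t"
    and energy: "\<And>c s t. c > 0 \<Longrightarrow> a \<le> s \<Longrightarrow> s \<le> t \<Longrightarrow> t \<le> b \<Longrightarrow>
        p * c powr (p - 1) * dist (u s) (u t) \<le> (E t - E s) + (p - 1) * c powr p * (t - s)"
  obtains g where "g \<in> borel_measurable borel" "\<And>x. 0 \<le> g x"
    "AE x in lborel. x \<in> {a<..<b} \<longrightarrow> ((\<lambda>s. dist (u s) (u x) / \<bar>x - s\<bar>) \<longlongrightarrow> g x) (at x)"
    "\<And>s t. a \<le> s \<Longrightarrow> s \<le> t \<Longrightarrow> t \<le> b \<Longrightarrow> set_integrable lborel {s..t} g"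
    "\<And>s t. a \<le> s \<Longrightarrow> s \<le> t \<Longrightarrow> t \<le> b \<Longrightarrow> dist (u s) (u t) \<le> (LINT r:{s..t}|lborel. g r)"
    "\<And>t. a \<le> t \<Longrightarrow> t \<le> b \<Longrightarrow> (\<integral>\<^sup>+r\<in>{a..t}. ennreal (g r powr p) \<partial>lborel) \<le> ennreal (E t - E a)"
proof -
  \<comment> \<open>For \<open>c = k \<eta>\<close> the factor \<open>p * c powr (p - 1)\<close> is \<open>1 / \<eta>\<close>.\<close>
  define k where "k \<eta> = (1 / (p * \<eta>)) powr (1 / (p - 1))" for \<eta>
  have small: "dist (u s) (u t) \<le> (\<eta> * E t + \<eta> * (p - 1) * k \<eta> powr p * t) - (\<eta> * E s + \<eta> * (p - 1) * k \<eta> powr p * s)"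
    if st: "a \<le> s" "s \<le> t" "t \<le> b" and \<eta>: "\<eta> > 0" for s t \<eta>
  proof -
    have "k \<eta> powr (p - 1) = 1 / (p * \<eta>)" using p \<eta> by (simp add: k_def powr_powr)
    then have "p * k \<eta> powr (p - 1) = 1 / \<eta>" using p by simp
    moreover have "k \<eta> > 0" using p \<eta> by (simp add: k_def)
    ultimately have "1 / \<eta> * dist (u s) (u t) \<le> (E t - E s) + (p - 1) * k \<eta> powr p * (t - s)"
      using energy[of "k \<eta>" s t] st by simp
    then show ?thesis using \<eta> by (simp add: field_simps)
  qed
  define Len where "Len = arc_length u a"
  note bound = small[where \<eta> = 1, simplified]
  have Len_step: "Len s + dist (u s) (u t) \<le> Len t" if "a \<le> s" "s \<le> t" "t \<le> b" for s t
    unfolding Len_def using arc_length_step[OF bound that] .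
  have Len_mono: "Len s \<le> Len t" if "a \<le> s" "s \<le> t" "t \<le> b" for s t
    using Len_step[OF that] zero_le_dist[of "u s" "u t"] by linarith
  define N where "N = {x\<in>{a<..<b}. \<nexists>L. ((\<lambda>s. dist (u s) (u x) / \<bar>x - s\<bar>) \<longlongrightarrow> L) (at x)
             \<and> (Len has_real_derivative L) (at x)}"
  have N: "negligible N" unfolding N_def Len_def by (rule metric_derivative_ae[OF bound ab])
  \<comment> \<open>Extending arc length by constants makes the difference quotients borel functions on the line.\<close>
  define cl where "cl x = max a (min b x)" for x
  have cl: "a \<le> cl x" "cl x \<le> b" "x \<le> y \<Longrightarrow> cl x \<le> cl y" "a \<le> x \<Longrightarrow> x \<le> b \<Longrightarrow> cl x = x" for x y
    using ab by (auto simp: cl_def)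
  have [measurable]: "(\<lambda>x. Len (cl x)) \<in> borel_measurable borel"
    by (rule borel_measurable_mono) (use cl Len_mono in \<open>auto simp: mono_def\<close>)
  define g where "g x = enn2real (liminf (\<lambda>n. ennreal ((Len (cl (x + 1 / Suc n)) - Len (cl x)) / (1 / Suc n))))
      * indicator {a<..<b} x" for x
  have g_meas[measurable]: "g \<in> borel_measurable borel" unfolding g_def by measurable
  have g0: "0 \<le> g x" for x by (simp add: g_def)
  have h: "(\<lambda>n. 1 / real (Suc n)) \<longlonglongrightarrow> 0"
    using LIMSEQ_inverse_real_of_nat by (simp add: inverse_eq_divide)
  have shift: "filterlim (\<lambda>n. x + 1 / real (Suc n)) (at x) sequentially" for x :: real
    using tendsto_add[OF tendsto_const[of x] h] by (auto simp: filterlim_at)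
  have near: "\<forall>\<^sub>F n in sequentially. x + 1 / real (Suc n) < t" if "x < t" for x t :: real
    using order_tendstoD(2)[OF h, of "t - x"] that by (auto elim!: eventually_mono)
  have g: "(Len has_real_derivative g x) (at x)" "((\<lambda>s. dist (u s) (u x) / \<bar>x - s\<bar>) \<longlongrightarrow> g x) (at x)"
    if x: "x \<in> {a<..<b}" "x \<notin> N" for x
  proof -
    obtain L where L: "((\<lambda>s. dist (u s) (u x) / \<bar>x - s\<bar>) \<longlongrightarrow> L) (at x)" "(Len has_real_derivative L) (at x)"
      using x unfolding N_def by blast
    have "(\<lambda>n. (Len (x + 1 / Suc n) - Len x) / (x + 1 / Suc n - x)) \<longlonglongrightarrow> L"
      using filterlim_compose[OF L(2)[unfolded has_field_derivative_iff] shift] .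
    then have "(\<lambda>n. (Len (cl (x + 1 / Suc n)) - Len (cl x)) / (1 / Suc n)) \<longlonglongrightarrow> L"
    proof (rule Lim_transform_eventually)
      have "x < b" using x by simp
      from near[OF this]
      show "\<forall>\<^sub>F n in sequentially. (Len (x + 1 / Suc n) - Len x) / (x + 1 / Suc n - x)
          = (Len (cl (x + 1 / Suc n)) - Len (cl x)) / (1 / Suc n)"
      proof eventually_elim
        case (elim n)
        then have "a \<le> x + 1 / Suc n" using x by (simp add: add_increasing2)
        then show ?case using elim x by (simp add: cl(4))
      qed
    qed
    then have "(\<lambda>n. ennreal ((Len (cl (x + 1 / Suc n)) - Len (cl x)) / (1 / Suc n))) \<longlonglongrightarrow> ennreal L"
      by (rule tendsto_ennrealI)
    then have "liminf (\<lambda>n. ennreal ((Len (cl (x + 1 / Suc n)) - Len (cl x)) / (1 / Suc n))) = ennreal L"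
      by (intro lim_imp_Liminf) auto
    moreover have "L \<ge> 0" using L(1) by (rule tendsto_lowerbound) auto
    ultimately have "g x = L" using x by (simp add: g_def)
    then show "(Len has_real_derivative g x) (at x)" "((\<lambda>s. dist (u s) (u x) / \<bar>x - s\<bar>) \<longlongrightarrow> g x) (at x)"
      using L by auto
  qed
  have hi: "(g has_integral (Len t - Len s)) {s..t}" if st: "a \<le> s" "s \<le> t" "t \<le> b" for s t
  proof (rule has_integral_derivative_ae[OF st(2)])
    show "negligible (N \<union> {s, t})" using N by simp
    show "(Len has_real_derivative g x) (at x within {s..t})" if "x \<in> {s..t} - (N \<union> {s, t})" for x
      using g(1)[of x] that st by (auto intro: has_field_derivative_at_within)
    show "\<exists>C. \<forall>s' t'. s \<le> s' \<longrightarrow> s' \<le> t' \<longrightarrow> t' \<le> t \<longrightarrow> Len t' - Len s' \<le> C * (t' - s') + \<eta> * (E t' - E s')"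
      if "\<eta> > 0" for \<eta>
    proof (intro exI[of _ "\<eta> * (p - 1) * k \<eta> powr p"] allI impI)
      fix s' t' assume "s \<le> s'" "s' \<le> t'" "t' \<le> t"
      then show "Len t' - Len s' \<le> \<eta> * (p - 1) * k \<eta> powr p * (t' - s') + \<eta> * (E t' - E s')"
        using arc_length_diff_le[where a = a and b = b and u = u and B = "\<lambda>t. \<eta> * E t + \<eta> * (p - 1) * k \<eta> powr p * t",
            OF small[OF _ _ _ that], of s' t'] st
        unfolding Len_def by (simp add: algebra_simps)
    qed
  qed (use st Len_mono monoE in auto)
  have nn: "(\<integral>\<^sup>+r. ennreal (indicator {s..t} r * g r) \<partial>lborel) = ennreal (Len t - Len s)"
    if "a \<le> s" "s \<le> t" "t \<le> b" for s t
    using nn_integral_has_integral_lebesgue[OF g0 hi[OF that]] .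
  have int: "set_integrable lborel {s..t} g" if "a \<le> s" "s \<le> t" "t \<le> b" for s t
    unfolding set_integrable_def using nn[OF that] g0 by (intro integrableI_nonneg) auto
  have lint: "(LINT r:{s..t}|lborel. g r) = Len t - Len s" if st: "a \<le> s" "s \<le> t" "t \<le> b" for s t
    unfolding set_lebesgue_integral_def
    by (rule integral_eq_nn_integral[THEN trans]) (use nn[OF st] Len_mono[OF st] g0 in auto)
  have ae: "AE x in lborel. x \<notin> N"
  proof -
    have "N \<in> null_sets lebesgue" using N by (simp only: negligible_iff_null_sets)
    then have "AE x in lebesgue. x \<notin> N" by (rule AE_not_in)
    then show ?thesis by (simp only: AE_completion_iff)
  qed
  show thesis
  proof (rule that[OF g_meas g0 _ int])
    show "AE x in lborel. x \<in> {a<..<b} \<longrightarrow> ((\<lambda>s. dist (u s) (u x) / \<bar>x - s\<bar>) \<longlongrightarrow> g x) (at x)"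
      using ae by eventually_elim (use g(2) in auto)
    show "dist (u s) (u t) \<le> (LINT r:{s..t}|lborel. g r)" if "a \<le> s" "s \<le> t" "t \<le> b" for s t
      using lint[OF that] Len_step[OF that] by simp
    fix t assume t: "a \<le> t" "t \<le> b"
    \<comment> \<open>\<open>E\<close> frozen after time \<open>t\<close>, so that its total increase is \<open>E t - E a\<close>.\<close>
    define F where "F x = E (max a (min t x)) - E a" for x
    have F: "mono F" "\<And>x. 0 \<le> F x" "\<And>x. F x \<le> E t - E a"
      using t monoE by (auto simp: F_def mono_def)
    have [measurable]: "F \<in> borel_measurable borel" using F(1) by (rule borel_measurable_mono)
    have pt: "ennreal (g x powr p) \<le> liminf (\<lambda>n. ennreal ((F (x + 1 / Suc n) - F x) / (1 / Suc n)))"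
      if x: "x \<in> {a<..<t}" "x \<notin> N" for x
    proof (cases "g x = 0")
      case False
      then have c: "g x > 0" using g0[of x] by simp
      have xb: "x \<in> {a<..<b}" and xt: "x < t" using x t by auto
      have lim: "(\<lambda>n. dist (u (x + 1 / Suc n)) (u x) / \<bar>x - (x + 1 / Suc n)\<bar>) \<longlonglongrightarrow> g x"
        using filterlim_compose[OF g(2)[OF xb x(2)] shift] .
      define A where "A n = p * g x powr (p - 1) * (dist (u (x + 1 / Suc n)) (u x) / \<bar>x - (x + 1 / Suc n)\<bar>) - (p - 1) * g x powr p" for n
      have "A \<longlonglongrightarrow> p * g x powr (p - 1) * g x - (p - 1) * g x powr p"
        unfolding A_def by (intro tendsto_intros lim)
      moreover have "p * g x powr (p - 1) * g x - (p - 1) * g x powr p = g x powr p"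
        using c powr_mult_base[of "g x" "p - 1"] by (simp add: algebra_simps)
      ultimately have "A \<longlonglongrightarrow> g x powr p" by (simp only:)
      then have "(\<lambda>n. ennreal (A n)) \<longlonglongrightarrow> ennreal (g x powr p)"
        by (rule tendsto_ennrealI)
      then have "ennreal (g x powr p) = liminf (\<lambda>n. ennreal (A n))"
        by (intro lim_imp_Liminf[symmetric]) auto
      also have "\<dots> \<le> liminf (\<lambda>n. ennreal ((F (x + 1 / Suc n) - F x) / (1 / Suc n)))"
      proof (rule Liminf_mono)
        show "\<forall>\<^sub>F n in sequentially. ennreal (A n)
            \<le> ennreal ((F (x + 1 / Suc n) - F x) / (1 / Suc n))"
          using near[of x t, OF xt]
        proof (eventually_elim)
          case (elim n)
          define h where "h = 1 / real (Suc n)"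
          have h: "h > 0" by (simp add: h_def)
          have xh: "x + h < t" using elim by (simp only: h_def)
          have "p * g x powr (p - 1) * dist (u x) (u (x + h)) \<le> (E (x + h) - E x) + (p - 1) * g x powr p * (x + h - x)"
            using xh x t h c by (intro energy) auto
          moreover have "F (x + h) - F x = E (x + h) - E x"
            using xh x h by (simp add: F_def)
          ultimately have "(p * g x powr (p - 1) * dist (u (x + h)) (u x) - (p - 1) * g x powr p * h) / h \<le> (F (x + h) - F x) / h"
            using h by (intro divide_right_mono) (auto simp: dist_commute)
          then have "p * g x powr (p - 1) * (dist (u (x + h)) (u x) / h) - (p - 1) * g x powr p \<le> (F (x + h) - F x) / h"
            using h by (simp add: diff_divide_distrib)
          then show ?case using h unfolding A_def h_def[symmetric] by (intro ennreal_leI) simp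
        qed
      qed
      finally show ?thesis .
    qed (use p in simp)
    have ae_t: "AE x in lborel. x \<notin> {a, t}"
      by (intro AE_not_in countable_imp_null_set_lborel) auto
    have "(\<integral>\<^sup>+r\<in>{a..t}. ennreal (g r powr p) \<partial>lborel)
        \<le> (\<integral>\<^sup>+x. liminf (\<lambda>n. ennreal ((F (x + 1 / Suc n) - F x) / (1 / Suc n)) * indicator {a..t} x) \<partial>lborel)"
      using ae ae_t
    proof (intro nn_integral_mono_AE, eventually_elim)
      case (elim x)
      then show ?case using pt[of x] by (auto split: split_indicator)
    qed
    also have "\<dots> \<le> liminf (\<lambda>n. \<integral>\<^sup>+x. ennreal ((F (x + 1 / Suc n) - F x) / (1 / Suc n)) * indicator {a..t} x \<partial>lborel)"
      by (rule nn_integral_liminf) measurable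
    also have "\<dots> \<le> liminf (\<lambda>n. ennreal (E t - E a))"
      by (intro Liminf_mono always_eventually allI nn_integral_mono_diff_quotient_le[OF F _ t(1)]) simp
    also have "\<dots> = ennreal (E t - E a)" by (rule Liminf_const) simp
    finally show "(\<integral>\<^sup>+r\<in>{a..t}. ennreal (g r powr p) \<partial>lborel) \<le> ennreal (E t - E a)" .
  qed
qed

section \<open>Compactness and lower semicontinuity\<close>

lemma limitin_subseq:
  "limitin \<sigma> x l sequentially \<Longrightarrow> strict_mono k \<Longrightarrow> limitin \<sigma> (\<lambda>n. x (k n)) l sequentially"
  using limitin_subsequence[of k \<sigma> x l] by (simp add: o_def)

lemma seq_compact_inE:
  fixes x :: "nat \<Rightarrow> 'a"
  assumes "seq_compact_in \<sigma> S" "\<And>n. x n \<in> S"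
  obtains l k where "l \<in> S" "strict_mono k" "limitin \<sigma> (\<lambda>n. x (k n)) l sequentially"
proof -
  have "range x \<subseteq> S" using assms(2) by auto
  from assms(1)[unfolded seq_compact_in_def, rule_format, OF this]
  show ?thesis using that by (auto simp: o_def)
qed

text \<open>The subsequence principle, which holds in every topological space.\<close>

lemma limitin_if_subseq_limitin:
  assumes "l \<in> topspace \<sigma>"
    and sub: "\<And>r :: nat \<Rightarrow> nat. strict_mono r \<Longrightarrow> \<exists>r'. strict_mono r' \<and> limitin \<sigma> (\<lambda>n. x (r (r' n))) l sequentially"
  shows "limitin \<sigma> x l sequentially"
proof (rule ccontr)
  assume "\<not> limitin \<sigma> x l sequentially"
  then obtain V where V: "openin \<sigma> V" "l \<in> V" "\<not> (\<forall>\<^sub>F n in sequentially. x n \<in> V)"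
    using assms(1) unfolding limitin_def by blast
  then have "infinite {n. x n \<notin> V}"
    by (simp add: not_eventually frequently_cofinite cofinite_eq_sequentially[symmetric])
  then obtain r :: "nat \<Rightarrow> nat" where r: "strict_mono r" "\<And>n. r n \<in> {n. x n \<notin> V}"
    using infinite_enumerate by blast
  then obtain r' where "limitin \<sigma> (\<lambda>n. x (r (r' n))) l sequentially" using sub by blast
  then have "\<forall>\<^sub>F n in sequentially. x (r (r' n)) \<in> V" using V unfolding limitin_def by blast
  then show False using r(2) by (auto simp: eventually_sequentially)
qed

lemma dist_limits_le:
  assumes "dist_compatible \<sigma>" "limitin \<sigma> x u sequentially" "limitin \<sigma> y v sequentially"
    and "\<forall>\<^sub>F n in sequentially. dist (x n) (y n) \<le> c n" and "c \<longlonglongrightarrow> C"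
  shows "dist u v \<le> C"
proof -
  have "ereal (dist u v) \<le> liminf (\<lambda>n. ereal (dist (x n) (y n)))"
    using assms(1-3) unfolding dist_compatible_def by blast
  also have "\<dots> \<le> liminf (\<lambda>n. ereal (c n))"
    using assms(4) by (intro Liminf_mono) (auto elim: eventually_mono)
  also have "\<dots> = ereal C"
    using assms(5) by (intro lim_imp_Liminf) auto
  finally show ?thesis by simp
qed

text \<open>Compatibility, applied to one sequence with two limits, bounds their distance by \<open>0\<close>.\<close>

lemma limit_unique_if_compatible:
  assumes "dist_compatible \<sigma>" "limitin \<sigma> x u sequentially" "limitin \<sigma> x v sequentially"
  shows "u = v"
  using dist_limits_le[OF assms, of "\<lambda>_. 0" 0] by simp

text \<open>A refined Arzela-Ascoli theorem.  A diagonal subsequence converges on a countable dense set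
  \<open>D\<close>.  At any other time all cluster points agree, because compatibility keeps them close to the limits at
  nearby points of \<open>D\<close>; with compactness this forces convergence.\<close>

theorem pointwise_compactness:
  fixes f :: "nat \<Rightarrow> real \<Rightarrow> 'a::metric_space" and I :: "real set"
  assumes top: "topspace \<sigma> = UNIV" and compat: "dist_compatible \<sigma>"
    and K: "seq_compact_in \<sigma> K" and fK: "\<And>n s. s \<in> I \<Longrightarrow> f n s \<in> K"
    and equi: "\<And>e. e > 0 \<Longrightarrow> \<exists>d>0. \<forall>s\<in>I. \<forall>t\<in>I. \<bar>s - t\<bar> < d \<longrightarrow>
                 (\<forall>\<^sub>F n in sequentially. dist (f n s) (f n t) \<le> e)"
  shows "\<exists>k w. strict_mono k \<and> (\<forall>s\<in>I. limitin \<sigma> (\<lambda>n. f (k n) s) (w s) sequentially)"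
proof (cases "I = {}")
  case True
  then show ?thesis by (intro exI[of _ id]) (simp add: strict_mono_def)
next
  case False
  have compact: "\<exists>l (r :: nat \<Rightarrow> nat). strict_mono r \<and> limitin \<sigma> (\<lambda>n. x (r n)) l sequentially"
    if "\<And>n. x n \<in> K" for x
    by (rule seq_compact_inE[OF K, of x, OF that]) blast
  obtain D where D: "countable D" "D \<subseteq> I" "I \<subseteq> closure D" using separable by blast
  have "D \<noteq> {}" using D False by auto
  define e where "e = from_nat_into D"
  have e: "range e = D" using D(1) \<open>D \<noteq> {}\<close> by (simp add: e_def range_from_nat_into)
  interpret subseqs "\<lambda>n r. \<exists>l. limitin \<sigma> (\<lambda>i. f (r i) (e n)) l sequentially"
  proof
    fix n and s :: "nat \<Rightarrow> nat" assume "strict_mono s"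
    have "f (s i) (e n) \<in> K" for i using fK e D(2) by blast
    from compact[of "\<lambda>i. f (s i) (e n)", OF this]
    show "\<exists>r'. strict_mono r' \<and> (\<exists>l. limitin \<sigma> (\<lambda>i. f ((s \<circ> r') i) (e n)) l sequentially)"
      by auto
  qed
  have diag: "\<exists>l. limitin \<sigma> (\<lambda>i. f (diagseq i) (e n)) l sequentially" for n
  proof -
    have "\<exists>l. limitin \<sigma> (\<lambda>i. f (((diagseq \<circ> (+) (Suc n))) i) (e n)) l sequentially"
    proof (rule diagseq_holds)
      fix x and s :: "nat \<Rightarrow> nat" and n
      assume "strict_mono s" "\<exists>l. limitin \<sigma> (\<lambda>i. f (x i) (e n)) l sequentially"
      then show "\<exists>l. limitin \<sigma> (\<lambda>i. f ((x \<circ> s) i) (e n)) l sequentially"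
        using limitin_subseq by fastforce
    qed
    then obtain l where "limitin \<sigma> (\<lambda>i. f (diagseq (i + Suc n)) (e n)) l sequentially"
      by (auto simp: add.commute)
    then have "limitin \<sigma> (\<lambda>i. f (diagseq i) (e n)) l sequentially"
      using limitin_sequentially_offset_rev by fast
    then show ?thesis ..
  qed
  have D_lim: "\<exists>l. limitin \<sigma> (\<lambda>i. f (diagseq i) s) l sequentially" if "s \<in> D" for s
    using diag that e by blast
  have "\<exists>l. limitin \<sigma> (\<lambda>i. f (diagseq i) s) l sequentially" if s: "s \<in> I" for s
  proof -
    obtain l and r :: "nat \<Rightarrow> nat" where l: "strict_mono r" "limitin \<sigma> (\<lambda>n. f (diagseq (r n)) s) l sequentially"
      using compact[of "\<lambda>n. f (diagseq n) s"] fK s by blast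
    have "limitin \<sigma> (\<lambda>i. f (diagseq i) s) l sequentially"
    proof (rule limitin_if_subseq_limitin)
      fix q :: "nat \<Rightarrow> nat" assume q: "strict_mono q"
      obtain l' and r' :: "nat \<Rightarrow> nat" where l': "strict_mono r'" "limitin \<sigma> (\<lambda>n. f (diagseq (q (r' n))) s) l' sequentially"
        using compact[of "\<lambda>n. f (diagseq (q n)) s"] fK s by blast
      \<comment> \<open>Two cluster points at \<open>s\<close> are both close to the limit at a nearby point of \<open>D\<close>.\<close>
      have "dist l l' \<le> e'" if e0: "e' > 0" for e'
      proof -
        obtain d where d: "d > 0" "\<And>s t. s \<in> I \<Longrightarrow> t \<in> I \<Longrightarrow> \<bar>s - t\<bar> < d \<Longrightarrow>
            (\<forall>\<^sub>F n in sequentially. dist (f n s) (f n t) \<le> e' / 2)"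
          using equi[of "e' / 2"] e0 by (meson half_gt_zero)
        obtain x where x: "x \<in> D" "\<bar>x - s\<bar> < d"
          using D(3) s d(1) closure_approachable[of s D] by (auto simp: dist_real_def)
        obtain m where m: "limitin \<sigma> (\<lambda>i. f (diagseq i) x) m sequentially" using D_lim x by blast
        have ev: "\<forall>\<^sub>F n in sequentially. dist (f n x) (f n s) \<le> e' / 2"
          using d(2)[of x s] x D(2) s by auto
        have close: "dist m v \<le> e' / 2"
          if "strict_mono j" "limitin \<sigma> (\<lambda>n. f (diagseq (j n)) s) v sequentially" for j v
        proof (rule dist_limits_le[OF compat limitin_subseq[OF m that(1)] that(2) _ tendsto_const])
          have "strict_mono (\<lambda>n. diagseq (j n))"
            using subseq_diagseq that(1) by (simp add: strict_mono_def)
          then show "\<forall>\<^sub>F n in sequentially. dist (f (diagseq (j n)) x) (f (diagseq (j n)) s) \<le> e' / 2"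
            using eventually_compose_filterlim[OF ev filterlim_subseq] by blast
        qed
        have "strict_mono (\<lambda>n. q (r' n))" using q l'(1) by (simp add: strict_mono_def)
        from close[OF l] close[OF this l'(2)] show ?thesis
          using dist_triangle2[of l l' m] by (simp add: dist_commute)
      qed
      then have "l' = l" by (metis dist_le_zero_iff field_le_epsilon add_0)
      then show "\<exists>r'. strict_mono r' \<and> limitin \<sigma> (\<lambda>n. f (diagseq (q (r' n))) s) l sequentially"
        using l' by blast
    qed (simp add: top)
    then show ?thesis ..
  qed
  then have "\<forall>s\<in>I. \<exists>l. limitin \<sigma> (\<lambda>i. f (diagseq i) s) l sequentially" by simp
  from bchoice[OF this] obtain w where "\<forall>s\<in>I. limitin \<sigma> (\<lambda>i. f (diagseq i) s) (w s) sequentially" ..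
  then show ?thesis using subseq_diagseq by blast
qed

text \<open>Part of the sequence lies in the sublevel; by compactness it has a cluster point there, and that
  point is \<open>l\<close>.\<close>

lemma sublevel_limit:
  assumes "dist_compatible \<sigma>" "seq_compact_in \<sigma> (sublevel \<phi> c)"
    and x: "limitin \<sigma> x l sequentially" and c: "\<exists>\<^sub>F n in sequentially. \<phi> (x n) \<le> ereal c"
  shows "\<phi> l \<le> ereal c"
proof -
  have "infinite {n. \<phi> (x n) \<le> ereal c}"
    using c by (simp add: cofinite_eq_sequentially[symmetric] frequently_cofinite)
  then obtain r :: "nat \<Rightarrow> nat" where r: "strict_mono r" "\<And>n. \<phi> (x (r n)) \<le> ereal c"
    using infinite_enumerate by blast
  then have "x (r n) \<in> sublevel \<phi> c" for n by (auto simp: sublevel_def)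
  then obtain l' and k :: "nat \<Rightarrow> nat" where l': "l' \<in> sublevel \<phi> c" "strict_mono k" "limitin \<sigma> (\<lambda>n. x (r (k n))) l' sequentially"
    by (rule seq_compact_inE[OF assms(2), of "\<lambda>n. x (r n)"])
  have "limitin \<sigma> (\<lambda>n. x (r (k n))) l sequentially"
    using limitin_subseq[OF limitin_subseq[OF x r(1)] l'(2)] .
  then have "l' = l" using limit_unique_if_compatible[OF assms(1) l'(3)] by simp
  then show ?thesis using l'(1) by (simp add: sublevel_def)
qed

lemma functional_lsc:
  assumes "dist_compatible \<sigma>" "\<And>c. seq_compact_in \<sigma> (sublevel \<phi> c)" "limitin \<sigma> x l sequentially"
  shows "\<phi> l \<le> liminf (\<lambda>n. \<phi> (x n))"
proof (rule ccontr)
  assume "\<not> ?thesis"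
  then obtain c where c: "liminf (\<lambda>n. \<phi> (x n)) < ereal c" "ereal c < \<phi> l"
    using ereal_dense2 by (auto simp: not_le)
  have "\<exists>\<^sub>F n in sequentially. \<phi> (x n) \<le> ereal c"
  proof (rule ccontr)
    assume "\<not> ?thesis"
    then have "ereal c \<le> liminf (\<lambda>n. \<phi> (x n))"
      by (intro Liminf_bounded) (auto simp: frequently_def not_le elim!: eventually_mono)
    then show False using c by simp
  qed
  from sublevel_limit[OF assms(1,2,3) this] show False using c by simp
qed

text \<open>A sequence along which \<open>\<phi>\<close> tends to \<open>-\<infinity>\<close> would have a cluster point in every
  sublevel.\<close>

lemma functional_bounded_below:
  assumes "dist_compatible \<sigma>" and K: "\<And>c. seq_compact_in \<sigma> (sublevel \<phi> c)" and "\<And>x. \<phi> x \<noteq> -\<infinity>"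
  shows "\<exists>b. \<forall>x. ereal b \<le> \<phi> x"
proof (rule ccontr)
  assume "\<not> ?thesis"
  then have "\<exists>x. \<phi> x < ereal b" for b by (auto simp: not_le)
  then have "\<forall>n :: nat. \<exists>x. \<phi> x < ereal (- real n)" by blast
  then obtain x where x: "\<And>n :: nat. \<phi> (x n) < ereal (- real n)" by metis
  have "\<phi> (x n) \<le> ereal 0" for n
    using x[of n] by (meson less_eq_ereal_def ereal_less_eq(3) neg_le_0_iff_le of_nat_0_le_iff order_trans)
  then have "x n \<in> sublevel \<phi> 0" for n by (simp add: sublevel_def)
  then obtain l and k :: "nat \<Rightarrow> nat" where l: "strict_mono k" "limitin \<sigma> (\<lambda>n. x (k n)) l sequentially"
    by (rule seq_compact_inE[OF K])
  have "\<phi> l \<le> ereal c" for c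
  proof (rule sublevel_limit[OF assms(1) K l(2)])
    have "\<forall>\<^sub>F n in sequentially. \<phi> (x (k n)) \<le> ereal c"
      using eventually_ge_at_top[of "nat \<lceil>- c\<rceil>"]
    proof eventually_elim
      case (elim n)
      then have "- real (k n) \<le> c" using seq_suble[OF l(1), of n] by linarith
      then show ?case using x[of "k n"] by (meson ereal_less_eq(3) less_imp_le order_trans)
    qed
    then show "\<exists>\<^sub>F n in sequentially. \<phi> (x (k n)) \<le> ereal c"
      by (intro eventually_frequently) auto
  qed
  then have "\<phi> l = -\<infinity>" by (metis ereal_bot)
  then show False using assms(3) by simp
qed

section \<open>Lower limits, Young inequalities and weak derivatives\<close>

lemma liminf_add_ge:
  fixes x y :: "nat \<Rightarrow> real"
  assumes "ereal a \<le> liminf (\<lambda>n. ereal (x n))" "ereal b \<le> liminf (\<lambda>n. ereal (y n))"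
  shows "ereal (a + b) \<le> liminf (\<lambda>n. ereal (x n + y n))"
proof -
  have "liminf (\<lambda>n. ereal (x n)) + liminf (\<lambda>n. ereal (y n)) \<le> liminf (\<lambda>n. ereal (x n) + ereal (y n))"
    using assms by (intro ereal_liminf_add_mono) auto
  moreover have "ereal a + ereal b \<le> liminf (\<lambda>n. ereal (x n)) + liminf (\<lambda>n. ereal (y n))"
    using assms by (rule add_mono)
  ultimately show ?thesis by simp
qed

lemma liminf_cmult_ge:
  fixes x :: "nat \<Rightarrow> real"
  assumes "ereal a \<le> liminf (\<lambda>n. ereal (x n))" "c > 0"
  shows "ereal (c * a) \<le> liminf (\<lambda>n. ereal (c * x n))"
proof -
  have "ereal c * ereal a \<le> ereal c * liminf (\<lambda>n. ereal (x n))"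
    using assms by (intro ereal_mult_left_mono) auto
  also have "\<dots> = liminf (\<lambda>n. ereal c * ereal (x n))"
    using assms(2) by (intro Liminf_ereal_mult_left[symmetric]) auto
  finally show ?thesis by simp
qed

lemma liminf_tendsto_ge:
  fixes x :: "nat \<Rightarrow> real"
  assumes "x \<longlonglongrightarrow> a"
  shows "ereal a \<le> liminf (\<lambda>n. ereal (x n))"
  using lim_imp_Liminf[of sequentially "\<lambda>n. ereal (x n)" "ereal a"] assms by simp

text \<open>The power is increasing and continuous on \<open>[0,\<infinity>]\<close>: each level \<open>y\<close> below \<open>g\<^sup>a\<close> is the power of a
  level \<open>z\<close> below \<open>g\<close>.\<close>

lemma ennreal_powr_le_liminf:
  assumes "a > 0" "g \<le> liminf x"
  shows "ennreal_powr g a \<le> liminf (\<lambda>n. ennreal_powr (x n) a)"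
  unfolding le_Liminf_iff
proof (intro allI impI)
  fix y assume y: "y < ennreal_powr g a"
  then have yfin: "y < top" using top.not_eq_extremum by fastforce
  define z where "z = enn2real y powr (1 / a)"
  have zy: "ennreal (z powr a) = y"
    using yfin assms(1) by (simp add: z_def powr_powr)
  have z0: "z \<ge> 0" by (simp add: z_def)
  have "ennreal z < g"
  proof (cases g)
    case (real r)
    then have "z powr a < r powr a"
      using y unfolding ennreal_powr_def zy[symmetric] by (simp add: ennreal_less_iff)
    then have "z < r" using real assms(1) z0 by (meson leI powr_mono2 not_le less_imp_le)
    then show ?thesis using real z0 by (simp add: ennreal_less_iff)
  qed simp
  then have "ennreal z < liminf x" using assms(2) by (rule order_less_le_trans)
  then have "\<forall>\<^sub>F n in sequentially. ennreal z < x n" by (rule less_LiminfD)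
  then show "\<forall>\<^sub>F n in sequentially. y < ennreal_powr (x n) a"
  proof eventually_elim
    case (elim n)
    show ?case
    proof (cases "x n")
      case (real r)
      then have "z < r" using elim z0 by (simp add: ennreal_less_iff)
      then have "z powr a < r powr a" using assms(1) z0 by (intro powr_less_mono2) auto
      then have "y < ennreal (r powr a)" unfolding zy[symmetric] by (simp add: ennreal_less_iff)
      then show ?thesis using real by (simp add: ennreal_powr_def)
    next
      case top
      then show ?thesis using yfin by (simp add: ennreal_powr_def)
    qed
  qed
qed

lemma liminf_eq_real:
  fixes x :: "nat \<Rightarrow> real"
  assumes "\<And>n. 0 \<le> x n" "\<And>n. x n \<le> M"
  shows "ereal (real_of_ereal (liminf (\<lambda>n. ereal (x n)))) = liminf (\<lambda>n. ereal (x n))"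
proof -
  have "0 \<le> liminf (\<lambda>n. ereal (x n))"
    using assms(1) by (intro Liminf_bounded always_eventually) auto
  moreover have "liminf (\<lambda>n. ereal (x n)) \<le> liminf (\<lambda>n. ereal M)"
    using assms(2) by (intro Liminf_mono always_eventually) auto
  then have "liminf (\<lambda>n. ereal (x n)) \<le> ereal M" by (simp add: Liminf_const)
  ultimately show ?thesis by (cases "liminf (\<lambda>n. ereal (x n))") auto
qed

text \<open>The graph of \<open>z\<^sup>p\<close> lies above its tangent at \<open>c\<close>.\<close>

lemma power_above_tangent:
  fixes p c z :: real
  assumes "p > 1" "c > 0" "z \<ge> 0"
  shows "p * c powr (p - 1) * z \<le> z powr p + (p - 1) * c powr p"
proof -
  define q where "q = p / (p - 1)"
  have q: "q > 1" "1 / p + 1 / q = 1" using assms(1) by (auto simp: q_def field_simps)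
  have "z * c powr (p - 1) \<le> z powr p / p + (c powr (p - 1)) powr q / q"
    using Youngs_inequality[OF assms(1) q assms(3), of "c powr (p - 1)"] by simp
  also have "(c powr (p - 1)) powr q = c powr p"
    using assms(1) by (simp add: powr_powr q_def)
  finally show ?thesis using assms(1) by (simp add: q_def field_simps)
qed

lemma ennreal_Young:
  assumes "p > 1" "q > 1" "1 / p + 1 / q = 1" "y \<ge> 0"
  shows "x * ennreal y \<le> ennreal (1 / p) * ennreal (y powr p) + ennreal (1 / q) * ennreal_powr x q"
proof (cases x)
  case (real r)
  have "r * y \<le> r powr q / q + y powr p / p"
    using Youngs_inequality[of q p r y] assms real by (simp add: add.commute)
  then have "ennreal (r * y) \<le> ennreal (1 / p * y powr p + 1 / q * r powr q)"
    by (intro ennreal_leI) simp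
  also have "\<dots> = ennreal (1 / p) * ennreal (y powr p) + ennreal (1 / q) * ennreal (r powr q)"
    using assms by (simp add: ennreal_mult[symmetric] ennreal_plus[symmetric] del: ennreal_plus)
  finally show ?thesis using real assms by (simp add: ennreal_powr_def ennreal_mult)
next
  case top
  then show ?thesis using assms by (simp add: ennreal_powr_def ennreal_mult_top)
qed

lemma set_integral_Ioo_eq_Icc:
  fixes f :: "real \<Rightarrow> real"
  assumes "a \<le> b"
  shows "(LINT x:{a<..<b}|lborel. f x) = (LINT x:{a..b}|lborel. f x)"
  using interval_integral_Icc[OF assms, of f] interval_integral_Ioo[of "ereal a" "ereal b" f] assms by simp

text \<open>Integration by parts for a primitive that is merely absolutely continuous, by Fubini's
  theorem on the triangle \<open>r \<le> x\<close>.  The constant \<open>A\<close> drops out because \<open>\<zeta>\<close> vanishes at both ends.\<close>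

lemma integral_primitive_times_deriv:
  fixes \<kappa> \<zeta> :: "real \<Rightarrow> real"
  assumes T: "T > 0" and \<kappa>: "set_integrable lborel {0..T} \<kappa>" and \<zeta>: "test_function T \<zeta>"
  shows "(LINT x:{0<..<T}|lborel. (A - (LINT r:{0..x}|lborel. \<kappa> r)) * deriv \<zeta> x)
       = (LINT x:{0<..<T}|lborel. \<kappa> x * \<zeta> x)"
proof -
  have diff: "((deriv ^^ n) \<zeta>) differentiable (at x)" for n x
    using \<zeta> unfolding test_function_def by blast
  have D: "(\<zeta> has_real_derivative deriv \<zeta> x) (at x)" for x
    using diff[of 0 x] by (simp add: DERIV_deriv_iff_real_differentiable)
  have cont: "isCont (deriv \<zeta>) x" for x
    using diff[of 1 x] by (simp add: differentiable_imp_continuous_within)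
  have contD: "continuous_on UNIV (deriv \<zeta>)" using cont by (simp add: continuous_at_imp_continuous_on)
  then have [measurable]: "deriv \<zeta> \<in> borel_measurable borel" by (rule borel_measurable_continuous_onI)
  obtain a b where ab: "0 < a" "b < T" "\<And>x. x \<notin> {a..b} \<Longrightarrow> \<zeta> x = 0"
    using \<zeta> unfolding test_function_def by blast
  have ends: "\<zeta> 0 = 0" "\<zeta> T = 0" using ab by auto
  \<comment> \<open>As \<open>\<zeta> T = 0\<close>, only the lower endpoint contributes.\<close>
  have FTC: "(\<integral>x. deriv \<zeta> x * indicator {r..T} x \<partial>lborel) = - \<zeta> r" if "r \<le> T" for r
    using integral_FTC_Icc_real[OF that D cont] ends by simp
  define k where "k r = indicator {0..T} r * \<kappa> r" for r
  define z where "z x = indicator {0..T} x * deriv \<zeta> x" for x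
  have ki: "integrable lborel k" using \<kappa> by (simp add: set_integrable_def k_def[abs_def])
  have [measurable]: "k \<in> borel_measurable borel" using ki by simp
  have zi: "integrable lborel z"
    using borel_integrable_atLeastAtMost'[OF continuous_on_subset[OF contD subset_UNIV], of 0 T]
    by (simp add: set_integrable_def z_def[abs_def])
  have [measurable]: "z \<in> borel_measurable borel" unfolding z_def by measurable
  define f where "f x r = z x * k r * (if r \<le> x then 1 else 0)" for x r
  have [measurable]: "(\<lambda>(x, r). f x r) \<in> borel_measurable (lborel \<Otimes>\<^sub>M lborel)"
    unfolding f_def by measurable
  have "integrable (lborel \<Otimes>\<^sub>M lborel) (\<lambda>(x, r). z x * k r)"
  proof (rule lborel_pair.Fubini_integrable)
    show "AE x in lborel. integrable lborel (\<lambda>y. case (x, y) of (x, r) \<Rightarrow> z x * k r)"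
      using ki by simp
    show "integrable lborel (\<lambda>x. LINT y|lborel. norm (case (x, y) of (x, r) \<Rightarrow> z x * k r))"
      using zi by (simp add: abs_mult)
  qed measurable
  then have fint: "integrable (lborel \<Otimes>\<^sub>M lborel) (\<lambda>(x, r). f x r)"
    by (rule Bochner_Integration.integrable_bound) (auto simp: f_def)
  define K where "K x = (LINT r:{0..x}|lborel. \<kappa> r)" for x
  have inner1: "(\<integral>r. f x r \<partial>lborel) = z x * K x" for x
  proof (cases "x \<in> {0..T}")
    case True
    have "(\<integral>r. f x r \<partial>lborel) = (\<integral>r. z x * (indicator {0..x} r * \<kappa> r) \<partial>lborel)"
      using True by (intro Bochner_Integration.integral_cong) (auto simp: f_def k_def split: split_indicator)
    then show ?thesis by (simp add: K_def set_lebesgue_integral_def)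
  qed (simp add: f_def z_def)
  have inner2: "(\<integral>x. f x r \<partial>lborel) = - (k r * \<zeta> r)" for r
  proof (cases "r \<in> {0..T}")
    case True
    have "(\<integral>x. f x r \<partial>lborel) = (\<integral>x. k r * (deriv \<zeta> x * indicator {r..T} x) \<partial>lborel)"
      using True by (intro Bochner_Integration.integral_cong) (auto simp: f_def z_def split: split_indicator)
    then show ?thesis using FTC[of r] True by simp
  qed (simp add: f_def k_def)
  have zK: "integrable lborel (\<lambda>x. z x * K x)"
    using lborel_pair.integrable_fst[OF fint] by (simp add: inner1)
  have "(LINT x:{0<..<T}|lborel. (A - K x) * deriv \<zeta> x) = (LINT x:{0..T}|lborel. (A - K x) * deriv \<zeta> x)"
    using T by (intro set_integral_Ioo_eq_Icc) simp
  also have "\<dots> = (\<integral>x. A * z x - z x * K x \<partial>lborel)"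
    unfolding set_lebesgue_integral_def z_def
    by (intro Bochner_Integration.integral_cong) (auto simp: algebra_simps)
  also have "\<dots> = A * (\<integral>x. z x \<partial>lborel) - (\<integral>x. z x * K x \<partial>lborel)"
    using zi zK by simp
  also have "(\<integral>x. z x \<partial>lborel) = 0"
    using FTC[of 0] T ends by (simp add: z_def mult.commute)
  also have "(\<integral>x. z x * K x \<partial>lborel) = (\<integral>r. (\<integral>x. f x r \<partial>lborel) \<partial>lborel)"
    unfolding inner1[symmetric] by (rule lborel_pair.Fubini_integral[symmetric]) (use fint in simp)
  also have "\<dots> = - (LINT r:{0..T}|lborel. \<kappa> r * \<zeta> r)"
    by (simp add: inner2 k_def set_lebesgue_integral_def mult.assoc)
  finally show ?thesis
    unfolding K_def set_integral_Ioo_eq_Icc[OF less_imp_le[OF T], of "\<lambda>x. \<kappa> x * \<zeta> x"] by simp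
qed

section \<open>The cells of a partition\<close>

text \<open>For \<open>s > 0\<close> the least such index is that of the half-open cell \<open>(t\<^sub>i\<^sub>-\<^sub>1, t\<^sub>i]\<close> that contains \<open>s\<close>, and
  for \<open>s = 0\<close> it is \<open>0\<close>.  Thus it covers both cases of the backward interpolant at once.\<close>

definition idx :: "(nat \<Rightarrow> real) \<Rightarrow> real \<Rightarrow> nat" where
  "idx t s = (LEAST i. s \<le> t i)"

lemma partition_strict_mono:
  assumes "time_partition T N t" "i < j" "j \<le> N"
  shows "t i < t j"
  using assms(2,3)
proof (induction j)
  case (Suc j)
  then have "t j < t (Suc j)" using assms(1) by (simp add: time_partition_def)
  then show ?case using Suc by (cases "i = j") auto
qed simp

lemma partition_mono: "time_partition T N t \<Longrightarrow> i \<le> j \<Longrightarrow> j \<le> N \<Longrightarrow> t i \<le> t j"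
  using partition_strict_mono[of T N t i j] by (cases "i = j") (auto intro: less_imp_le)

lemma step_pos: "time_partition T N t \<Longrightarrow> i \<in> {1..N} \<Longrightarrow> 0 < step t i"
  using partition_strict_mono[of T N t "i - 1" i] by (auto simp: step_def)

lemma step_le_fineness: "i \<in> {1..N} \<Longrightarrow> step t i \<le> fineness N t"
  unfolding fineness_def by (intro Max_ge) auto

context
  fixes T :: real and N :: nat and t :: "nat \<Rightarrow> real"
  assumes part: "time_partition T N t"
begin

lemma idx_props:
  assumes "s \<le> T"
  shows idx_le: "idx t s \<le> N" and le_idx: "s \<le> t (idx t s)"
    and idx_least: "i < idx t s \<Longrightarrow> t i < s"
proof -
  have N: "s \<le> t N" using part assms by (simp add: time_partition_def)
  show "idx t s \<le> N" unfolding idx_def using N by (rule Least_le)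
  show "s \<le> t (idx t s)" unfolding idx_def using N by (rule LeastI)
  show "t i < s" if "i < idx t s" using not_less_Least[of i "\<lambda>i. s \<le> t i"] that
    by (simp add: idx_def)
qed

lemma idx_mono:
  assumes "s \<le> s'" "s' \<le> T"
  shows "idx t s \<le> idx t s'"
  unfolding idx_def[of t s] using assms le_idx[of s'] by (intro Least_le) linarith

lemma idx_0: "idx t 0 = 0"
  unfolding idx_def using part by (intro Least_equality) (auto simp: time_partition_def)

lemma idx_pos: "0 < s \<Longrightarrow> s \<le> T \<Longrightarrow> idx t s \<in> {1..N}"
  using le_idx[of s] idx_le[of s] part
  by (cases "idx t s") (auto simp: time_partition_def)

lemma idx_interval:
  assumes "0 < s" "s \<le> T"
  shows "s \<in> {t (idx t s - 1)<..t (idx t s)}"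
  using idx_pos[OF assms] idx_least[OF assms(2), of "idx t s - 1"] le_idx[OF assms(2)] by auto

lemma idx_unique:
  assumes "i \<in> {1..N}" "s \<in> {t (i - 1)<..t i}"
  shows "idx t s = i"
  unfolding idx_def
proof (rule Least_equality)
  fix j assume j: "s \<le> t j"
  show "i \<le> j"
  proof (rule ccontr)
    assume "\<not> i \<le> j"
    then have "t j \<le> t (i - 1)"
      using partition_strict_mono[OF part, of j "i - 1"] assms(1)
      by (cases "j = i - 1") (auto intro: less_imp_le)
    then show False using j assms(2) by auto
  qed
qed (use assms in auto)

lemma backward_interp_eq_idx:
  assumes "0 \<le> s" "s \<le> T"
  shows "backward_interp N t u s = u (idx t s)"
proof (cases "s = 0")
  case False
  then have s: "0 < s" using assms by simp
  have "(THE i. i \<in> {1..N} \<and> s \<in> {t (i - 1)<..t i}) = idx t s"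
  proof (rule the_equality)
    show "idx t s \<in> {1..N} \<and> s \<in> {t (idx t s - 1)<..t (idx t s)}"
      using idx_pos[OF s assms(2)] idx_interval[OF s assms(2)] by (rule conjI)
    show "i = idx t s" if "i \<in> {1..N} \<and> s \<in> {t (i - 1)<..t i}" for i
      using idx_unique that by blast
  qed
  then show ?thesis using False by (simp only: backward_interp_def if_False)
qed (simp add: backward_interp_def idx_0)

lemma fineness_nonneg:
  assumes "0 < T"
  shows "0 \<le> fineness N t"
  using step_pos[OF part idx_pos[OF assms order_refl]] step_le_fineness[OF idx_pos[OF assms order_refl], of t]
  by linarith

lemma idx_time_le:
  assumes "0 \<le> s" "s \<le> T" "0 < T"
  shows "t (idx t s) \<le> s + fineness N t"
proof (cases "s = 0")
  case True
  then show ?thesis using idx_0 part fineness_nonneg assms by (simp add: time_partition_def)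
next
  case False
  then have s: "0 < s" using assms by simp
  have "t (idx t s) - t (idx t s - 1) \<le> fineness N t"
    using step_le_fineness[OF idx_pos[OF s assms(2)], of t] by (simp add: step_def)
  then show ?thesis using idx_interval[OF s assms(2)] by auto
qed

end

section \<open>The discrete energy inequality\<close>

text \<open>The integral of the \<open>p\<close>-th power of the speed of a curve that covers the distance
  \<open>d(u\<^sub>i\<^sub>-\<^sub>1, u\<^sub>i)\<close> at constant speed during the step \<open>i\<close>.\<close>

definition kinetic :: "real \<Rightarrow> (nat \<Rightarrow> real) \<Rightarrow> (nat \<Rightarrow> 'a::metric_space) \<Rightarrow> nat \<Rightarrow> real" where
  "kinetic p t u m = (\<Sum>i=1..m. step t i powr (1 - p) * dist (u (i - 1)) (u i) powr p)"

definition slope_sum :: "real \<Rightarrow> ('a::metric_space \<Rightarrow> ereal) \<Rightarrow> (nat \<Rightarrow> real) \<Rightarrow> (nat \<Rightarrow> 'a) \<Rightarrow> nat \<Rightarrow> real" where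
  "slope_sum q \<phi> t u m = (\<Sum>i=1..m. step t i * enn2real (local_slope \<phi> (u i)) powr q)"

lemma kinetic_nonneg: "0 \<le> kinetic p t u m"
  unfolding kinetic_def by (intro sum_nonneg) auto

lemma kinetic_mono: "i \<le> j \<Longrightarrow> kinetic p t u i \<le> kinetic p t u j"
  unfolding kinetic_def by (intro sum_mono2) auto

text \<open>\<open>power_above_tangent\<close> for the speed of each step, multiplied by the length of the step, is additive
  along the steps; the distances add up by the triangle inequality.\<close>

lemma discrete_energy_bound:
  assumes part: "time_partition T N t" and p: "p > 1" and c: "c > 0" and "i \<le> j" "j \<le> N"
  shows "p * c powr (p - 1) * dist (u i) (u j)
     \<le> (kinetic p t u j - kinetic p t u i) + (p - 1) * c powr p * (t j - t i)"
  using assms(4,5)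
proof (induction j rule: dec_induct)
  case (step j)
  define \<tau> where "\<tau> = t (Suc j) - t j"
  define d where "d = dist (u j) (u (Suc j))"
  have \<tau>: "\<tau> > 0" using partition_strict_mono[OF part, of j "Suc j"] step by (simp add: \<tau>_def)
  have "p * c powr (p - 1) * d = \<tau> * (p * c powr (p - 1) * (d / \<tau>))" using \<tau> by simp
  also have "\<dots> \<le> \<tau> * ((d / \<tau>) powr p + (p - 1) * c powr p)"
    using \<tau> by (intro mult_left_mono power_above_tangent p c) (auto simp: d_def)
  also have "\<dots> = \<tau> powr (1 - p) * d powr p + (p - 1) * c powr p * \<tau>"
    using \<tau> by (simp add: powr_divide d_def powr_diff field_simps)
  finally have "p * c powr (p - 1) * d \<le> (kinetic p t u (Suc j) - kinetic p t u j) + (p - 1) * c powr p * \<tau>"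
    by (simp add: kinetic_def d_def \<tau>_def Defs.step_def)
  moreover have "p * c powr (p - 1) * dist (u i) (u (Suc j)) \<le> p * c powr (p - 1) * dist (u i) (u j) + p * c powr (p - 1) * d"
    unfolding distrib_left[symmetric] d_def using p by (intro mult_left_mono dist_triangle) auto
  ultimately show ?case using step by (simp add: \<tau>_def algebra_simps)
qed simp

text \<open>The values of \<open>\<phi>\<close> telescope in the sum of the incremental functionals.\<close>

lemma discrete_energy_inequality:
  assumes "m \<le> N"
  shows "real_of_ereal (\<phi> (u m)) + kinetic p t u m / p + slope_sum q \<phi> t u m / q
      \<le> real_of_ereal (\<phi> (u 0)) + (\<Sum>i=1..N. max 0 (incr_G p q \<phi> (step t i) (u (i - 1)) (u i)))"
proof -
  have "real_of_ereal (\<phi> (u m)) + kinetic p t u m / p + slope_sum q \<phi> t u m / q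
      \<le> real_of_ereal (\<phi> (u 0)) + (\<Sum>i=1..m. max 0 (incr_G p q \<phi> (step t i) (u (i - 1)) (u i)))"
  proof (induction m)
    case (Suc m)
    have "incr_G p q \<phi> (step t (Suc m)) (u m) (u (Suc m))
      = real_of_ereal (\<phi> (u (Suc m))) - real_of_ereal (\<phi> (u m))
        + (kinetic p t u (Suc m) - kinetic p t u m) / p + (slope_sum q \<phi> t u (Suc m) - slope_sum q \<phi> t u m) / q"
      by (simp add: incr_G_def kinetic_def slope_sum_def)
    then show ?case using Suc by (simp add: diff_divide_distrib)
  qed (simp add: kinetic_def slope_sum_def)
  also have "\<dots> \<le> real_of_ereal (\<phi> (u 0)) + (\<Sum>i=1..N. max 0 (incr_G p q \<phi> (step t i) (u (i - 1)) (u i)))"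
    using assms by (intro add_left_mono sum_mono2) auto
  finally show ?thesis .
qed

locale discrete_flow =
  fixes p q T :: real
    and \<sigma> :: "'a::metric_space topology"
    and \<phi> :: "'a \<Rightarrow> ereal"
    and u0 :: 'a
    and N :: "nat \<Rightarrow> nat"
    and t :: "nat \<Rightarrow> nat \<Rightarrow> real"
    and u :: "nat \<Rightarrow> nat \<Rightarrow> 'a"
  assumes p: "p > 1" and q: "q > 1" and pq: "1 / p + 1 / q = 1" and T: "T > 0"
    and top: "topspace \<sigma> = UNIV" and compat: "dist_compatible \<sigma>"
    and proper: "\<And>x. \<phi> x \<noteq> -\<infinity>"
    and compact: "\<And>c. seq_compact_in \<sigma> (sublevel \<phi> c)"
    and gradient: "strong_upper_gradient p T \<phi> (local_slope \<phi>)"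
    and slope_lsc: "\<And>c B. bounded B \<Longrightarrow> seq_lsc_on \<sigma> (sublevel \<phi> c \<inter> B) (local_slope \<phi>)"
    and u0: "u0 \<in> eff_dom \<phi>"
    and part: "\<And>n. time_partition T (N n) (t n)"
    and fine: "(\<lambda>n. fineness (N n) (t n)) \<longlonglongrightarrow> 0"
    and initial: "\<And>n. u n 0 \<in> eff_dom \<phi>"
    and slope_dom: "\<And>n i. i \<in> {1..N n} \<Longrightarrow> u n i \<in> slope_dom \<phi>"
    and initial_bounded: "bounded (range (\<lambda>n. u n 0))"
    and initial_limit: "limitin \<sigma> (\<lambda>n. u n 0) u0 sequentially"
    and initial_energy: "(\<lambda>n. \<phi> (u n 0)) \<longlonglongrightarrow> \<phi> u0"
    and errors: "(\<lambda>n. \<Sum>i=1..N n. max 0 (incr_G p q \<phi> (step (t n) i) (u n (i - 1)) (u n i)))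
           \<longlonglongrightarrow> 0"
begin

text \<open>The real value of \<open>\<phi>\<close>, meaningful on the domain of \<open>\<phi>\<close>, in which all the discrete
  solutions lie.\<close>

abbreviation R :: "'a \<Rightarrow> real" where "R x \<equiv> real_of_ereal (\<phi> x)"

definition err :: "nat \<Rightarrow> real" where
  "err n = (\<Sum>i=1..N n. max 0 (incr_G p q \<phi> (step (t n) i) (u n (i - 1)) (u n i)))"

definition \<iota> :: "nat \<Rightarrow> real \<Rightarrow> nat" where "\<iota> n s = idx (t n) s"

definition kinetic_upto :: "nat \<Rightarrow> real \<Rightarrow> real" where "kinetic_upto n s = kinetic p (t n) (u n) (\<iota> n s)"

definition U :: "nat \<Rightarrow> real \<Rightarrow> 'a" where "U n s = u n (\<iota> n s)"

lemma U_eq: "s \<in> {0..T} \<Longrightarrow> backward_interp (N n) (t n) (u n) s = U n s"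
  unfolding U_def \<iota>_def by (rule backward_interp_eq_idx[OF part]) auto

lemma R_finite:
  assumes "x \<in> eff_dom \<phi>" shows "ereal (R x) = \<phi> x"
  using assms proper[of x] by (cases "\<phi> x") (auto simp: eff_dom_def)

lemma u_eff_dom: "i \<le> N n \<Longrightarrow> u n i \<in> eff_dom \<phi>"
  using initial[of n] slope_dom[of i n] by (cases "i = 0") (auto simp: slope_dom_def)

lemma R_initial: "(\<lambda>n. R (u n 0)) \<longlonglongrightarrow> R u0"
proof -
  have "(\<lambda>n. ereal (R (u n 0))) \<longlonglongrightarrow> ereal (R u0)"
    using initial_energy by (simp only: R_finite[OF initial] R_finite[OF u0])
  then show ?thesis by (simp only: lim_ereal)
qed

lemma budget_tendsto: "(\<lambda>n. R (u n 0) + err n) \<longlonglongrightarrow> R u0"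
  using tendsto_add[OF R_initial errors] by (simp only: err_def add_0_right)

lemma energy_inequality:
  "m \<le> N n \<Longrightarrow> R (u n m) + kinetic p (t n) (u n) m / p + slope_sum q \<phi> (t n) (u n) m / q \<le> R (u n 0) + err n"
  unfolding err_def by (rule discrete_energy_inequality)

lemma slope_sum_nonneg: "m \<le> N n \<Longrightarrow> 0 \<le> slope_sum q \<phi> (t n) (u n) m"
  unfolding slope_sum_def
proof (intro sum_nonneg)
  fix i assume "m \<le> N n" "i \<in> {1..m}"
  then have "0 < step (t n) i" using step_pos[OF part, of i n] by auto
  then show "0 \<le> step (t n) i * enn2real (local_slope \<phi> (u n i)) powr q" by simp
qed

text \<open>\<open>R (u n 0) + err n\<close> converges and therefore bounds \<open>\<phi>\<close> from above.  As \<open>\<phi>\<close> is bounded below, it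
  also bounds the two sums of nonnegative terms.\<close>

lemma uniform_bounds:
  "\<exists>C M. (\<forall>n. \<forall>s\<in>{0..T}. \<phi> (U n s) \<le> ereal C) \<and> 0 \<le> M \<and>
     (\<forall>n. \<forall>m\<le>N n. kinetic p (t n) (u n) m \<le> M \<and> slope_sum q \<phi> (t n) (u n) m \<le> M)"
proof -
  obtain b where b: "\<And>x. ereal b \<le> \<phi> x"
    using functional_bounded_below[OF compat compact proper] by blast
  obtain C where C: "\<And>n. R (u n 0) + err n \<le> C"
  proof -
    obtain C where "\<And>n. norm (R (u n 0) + err n) \<le> C"
      using convergent_imp_bounded[OF budget_tendsto] unfolding bounded_iff by blast
    then have "\<And>n. R (u n 0) + err n \<le> C" by (simp add: abs_le_iff)
    then show thesis by (rule that)
  qed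
  have Rb: "b \<le> R (u n m)" if "m \<le> N n" for n m
    using b[of "u n m"] R_finite[OF u_eff_dom[OF that]] by (metis ereal_less_eq(3))
  have RC: "R (u n m) \<le> C" if "m \<le> N n" for n m
  proof -
    have "0 \<le> kinetic p (t n) (u n) m / p" "0 \<le> slope_sum q \<phi> (t n) (u n) m / q"
      using kinetic_nonneg[of p "t n" "u n" m] slope_sum_nonneg[OF that] p q by auto
    then show ?thesis using energy_inequality[OF that] C[of n] by linarith
  qed
  have Cb: "0 \<le> C - b" using Rb[of 0 0] RC[of 0 0] by simp
  show ?thesis
  proof (rule exI[of _ C], rule exI[of _ "p * (C - b) + q * (C - b)"], intro conjI allI impI ballI)
    fix n and s :: real assume "s \<in> {0..T}"
    then have i: "\<iota> n s \<le> N n" using idx_le[OF part] by (simp add: \<iota>_def)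
    show "\<phi> (U n s) \<le> ereal C"
      using RC[OF i] unfolding U_def by (subst R_finite[OF u_eff_dom[OF i], symmetric]) simp
  next
    show "0 \<le> p * (C - b) + q * (C - b)" using Cb p q by simp
  next
    fix n m assume m: "m \<le> N n"
    have nn: "0 \<le> slope_sum q \<phi> (t n) (u n) m / q" "0 \<le> kinetic p (t n) (u n) m / p"
      using slope_sum_nonneg[OF m] kinetic_nonneg[of p "t n" "u n" m] p q by auto
    have pb: "0 \<le> p * (C - b)" "0 \<le> q * (C - b)" using Cb p q by auto
    have "kinetic p (t n) (u n) m / p \<le> C - b" "slope_sum q \<phi> (t n) (u n) m / q \<le> C - b"
      using nn energy_inequality[OF m] C[of n] Rb[OF m] by linarith+
    then have "kinetic p (t n) (u n) m \<le> p * (C - b)" "slope_sum q \<phi> (t n) (u n) m \<le> q * (C - b)"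
      using p q by (simp_all add: divide_le_eq mult.commute)
    then show "kinetic p (t n) (u n) m \<le> p * (C - b) + q * (C - b)"
        "slope_sum q \<phi> (t n) (u n) m \<le> p * (C - b) + q * (C - b)"
      using pb by linarith+
  qed
qed

text \<open>The interpolant jumps at the nodes, so times are rounded up to the next node; the fineness
  is the price.\<close>

lemma interpolant_energy_bound:
  assumes "c > 0" "0 \<le> s" "s \<le> s'" "s' \<le> T"
  shows "p * c powr (p - 1) * dist (U n s) (U n s')
     \<le> (kinetic_upto n s' - kinetic_upto n s) + (p - 1) * c powr p * (s' - s + fineness (N n) (t n))"
proof -
  have "p * c powr (p - 1) * dist (U n s) (U n s')
     \<le> (kinetic_upto n s' - kinetic_upto n s) + (p - 1) * c powr p * (t n (\<iota> n s') - t n (\<iota> n s))"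
    unfolding U_def kinetic_upto_def \<iota>_def using assms p
    by (intro discrete_energy_bound[OF part] idx_mono[OF part] idx_le[OF part]) auto
  also have "\<dots> \<le> (kinetic_upto n s' - kinetic_upto n s) + (p - 1) * c powr p * (s' - s + fineness (N n) (t n))"
    using p idx_time_le[OF part, of s' n] le_idx[OF part, of s n] assms T unfolding \<iota>_def
    by (intro add_left_mono mult_left_mono) auto
  finally show ?thesis .
qed

text \<open>In \<open>interpolant_energy_bound\<close> the kinetic term stays below \<open>M\<close>, so a large \<open>c\<close> makes it
  negligible against the factor \<open>p c\<^sup>p\<^sup>-\<^sup>1\<close>; short times and a small fineness then control the
  rest.\<close>

lemma interpolants_converge:
  "\<exists>k w. strict_mono k \<and> (\<forall>s\<in>{0..T}. limitin \<sigma> (\<lambda>n. U (k n) s) (w s) sequentially)"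
proof -
  obtain C M where C: "\<And>n s. s \<in> {0..T} \<Longrightarrow> \<phi> (U n s) \<le> ereal C" and M: "M \<ge> 0"
    "\<And>n m. m \<le> N n \<Longrightarrow> kinetic p (t n) (u n) m \<le> M"
    using uniform_bounds by blast
  have "\<exists>d>0. \<forall>s\<in>{0..T}. \<forall>s'\<in>{0..T}. \<bar>s - s'\<bar> < d \<longrightarrow> (\<forall>\<^sub>F n in sequentially. dist (U n s) (U n s') \<le> e)"
    if e: "e > 0" for e
  proof -
    \<comment> \<open>Chosen such that \<open>p * c powr (p - 1) * e = 2 * (M + 1)\<close>: one half pays for the kinetic term, the other for the time.\<close>
    define c where "c = ((M + 1) / (p * e / 2)) powr (1 / (p - 1))"
    have c: "c > 0" using M(1) p e by (auto simp: c_def)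
    have "c powr (p - 1) = (M + 1) / (p * e / 2)"
      using p M(1) e by (simp add: c_def powr_powr)
    then have pc: "p * c powr (p - 1) * (e / 2) = M + 1" using p e by (simp add: field_simps)
    define \<kappa> where "\<kappa> = (p - 1) * c powr p"
    have \<kappa>: "\<kappa> > 0" using p c by (simp add: \<kappa>_def)
    define d where "d = (M + 1) / (2 * \<kappa>)"
    have d: "d > 0" using \<kappa> M(1) by (simp add: d_def)
    have near: "dist (U n s) (U n s') \<le> e"
      if s: "0 \<le> s" "s \<le> s'" "s' \<le> T" "s' - s < d" and n: "fineness (N n) (t n) < d" for s s' n
    proof -
      have "kinetic_upto n s' - kinetic_upto n s \<le> M"
        using M(2)[of "\<iota> n s'" n] idx_le[OF part, of s' n] s kinetic_nonneg[of p "t n" "u n" "\<iota> n s"]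
        by (simp add: kinetic_upto_def \<iota>_def)
      moreover have "\<kappa> * (s' - s + fineness (N n) (t n)) \<le> M + 1"
      proof -
        have "\<kappa> * (s' - s + fineness (N n) (t n)) \<le> \<kappa> * (2 * d)"
          using s n \<kappa> by (intro mult_left_mono) auto
        also have "\<dots> = M + 1" using \<kappa> by (simp add: d_def)
        finally show ?thesis .
      qed
      ultimately have "(kinetic_upto n s' - kinetic_upto n s) + \<kappa> * (s' - s + fineness (N n) (t n)) \<le> M + (M + 1)"
        by (rule add_mono)
      with interpolant_energy_bound[OF c s(1-3), of n, folded \<kappa>_def]
      have "p * c powr (p - 1) * dist (U n s) (U n s') \<le> M + (M + 1)"
        by (rule order_trans)
      also have "\<dots> \<le> p * c powr (p - 1) * e" using pc M(1) by simp
      finally show ?thesis using p c by simp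
    qed
    have "\<forall>\<^sub>F n in sequentially. fineness (N n) (t n) < d"
      using order_tendstoD(2)[OF fine d] .
    then have "\<forall>\<^sub>F n in sequentially. dist (U n s) (U n s') \<le> e"
      if "s \<in> {0..T}" "s' \<in> {0..T}" "\<bar>s - s'\<bar> < d" for s s'
    proof (rule eventually_mono)
      fix n assume "fineness (N n) (t n) < d"
      then show "dist (U n s) (U n s') \<le> e"
        using near[of s s' n] near[of s' s n] that by (cases "s \<le> s'") (auto simp: dist_commute)
    qed
    then show ?thesis using d by blast
  qed
  moreover have "U n s \<in> sublevel \<phi> C" if "s \<in> {0..T}" for n s
    using C[OF that] by (simp add: sublevel_def)
  ultimately show ?thesis
    by (rule pointwise_compactness[where f = U and I = "{0..T}", OF top compat compact[of C], rotated])
qed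

end

section \<open>The limit curve\<close>

locale flow_limit = discrete_flow +
  fixes k :: "nat \<Rightarrow> nat" and w :: "real \<Rightarrow> 'a"
  assumes k: "strict_mono k"
    and conv: "\<And>s. s \<in> {0..T} \<Longrightarrow> limitin \<sigma> (\<lambda>n. U (k n) s) (w s) sequentially"
begin

text \<open>A lower limit at each time separately; no convergence of the energies is extracted.\<close>

definition E :: "real \<Rightarrow> real" where
  "E s = real_of_ereal (liminf (\<lambda>n. ereal (kinetic_upto (k n) s)))"

lemma fine_k: "(\<lambda>n. fineness (N (k n)) (t (k n))) \<longlonglongrightarrow> 0"
  using LIMSEQ_subseq_LIMSEQ[OF fine k] by (simp add: o_def)

lemma budget_tendsto_k: "(\<lambda>n. R (u (k n) 0) + err (k n)) \<longlonglongrightarrow> R u0"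
  using LIMSEQ_subseq_LIMSEQ[OF budget_tendsto k] by (simp add: o_def)

lemma \<iota>_le: "s \<in> {0..T} \<Longrightarrow> \<iota> n s \<le> N n"
  using idx_le[OF part] by (simp add: \<iota>_def)

lemma \<iota>_0: "\<iota> n 0 = 0"
  unfolding \<iota>_def by (rule idx_0[OF part])

lemma E_eq: "s \<in> {0..T} \<Longrightarrow> ereal (E s) = liminf (\<lambda>n. ereal (kinetic_upto (k n) s))"
proof -
  assume s: "s \<in> {0..T}"
  obtain M where "\<And>n m. m \<le> N n \<Longrightarrow> kinetic p (t n) (u n) m \<le> M" using uniform_bounds by blast
  then have "kinetic_upto (k n) s \<le> M" for n using \<iota>_le[OF s] by (simp add: kinetic_upto_def)
  then show ?thesis unfolding E_def
    by (intro liminf_eq_real) (auto simp: kinetic_upto_def kinetic_nonneg)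
qed

lemma E_0: "E 0 = 0"
  by (simp add: E_def kinetic_upto_def \<iota>_0 kinetic_def Liminf_const)

lemma w_0: "w 0 = u0"
proof -
  have "limitin \<sigma> (\<lambda>n. U (k n) 0) u0 sequentially"
    using limitin_subseq[OF initial_limit k] by (simp add: U_def \<iota>_0)
  then show ?thesis using limit_unique_if_compatible[OF compat conv] T by simp
qed

lemma E_mono:
  assumes "0 \<le> s" "s \<le> s'" "s' \<le> T"
  shows "E s \<le> E s'"
proof -
  have "kinetic_upto n s \<le> kinetic_upto n s'" for n
    unfolding kinetic_upto_def \<iota>_def by (intro kinetic_mono idx_mono[OF part] assms)
  then have "ereal (E s) \<le> ereal (E s')"
    using assms by (subst (1 2) E_eq) (auto intro!: Liminf_mono)
  then show ?thesis by simp
qed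

text \<open>Superadditivity of the lower limit: \<open>E s'\<close> is at least \<open>E s\<close> plus the lower limit of what the
  increment of the kinetic energy dominates, namely a distance minus a convergent term.\<close>

lemma E_increment:
  assumes c: "c > 0" and s: "0 \<le> s" "s \<le> s'" "s' \<le> T"
  shows "p * c powr (p - 1) * dist (w s) (w s') \<le> (E s' - E s) + (p - 1) * c powr p * (s' - s)"
proof -
  define \<kappa> where "\<kappa> = p * c powr (p - 1)"
  define \<rho> where "\<rho> = (p - 1) * c powr p"
  define f where "f n = fineness (N (k n)) (t (k n))" for n
  have \<kappa>: "\<kappa> > 0" using p c by (simp add: \<kappa>_def)
  have "ereal (dist (w s) (w s')) \<le> liminf (\<lambda>n. ereal (dist (U (k n) s) (U (k n) s')))"
    using compat conv[of s] conv[of s'] s unfolding dist_compatible_def by auto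
  from liminf_cmult_ge[OF this \<kappa>]
  have "ereal (\<kappa> * dist (w s) (w s') + E s) \<le> liminf (\<lambda>n. ereal (\<kappa> * dist (U (k n) s) (U (k n) s') + kinetic_upto (k n) s))"
    by (rule liminf_add_ge) (use E_eq[of s] s in auto)
  moreover have "(\<lambda>n. - \<rho> * (s' - s + f n)) \<longlonglongrightarrow> - \<rho> * (s' - s + 0)"
    unfolding f_def by (intro tendsto_intros fine_k)
  ultimately have "ereal (\<kappa> * dist (w s) (w s') + E s + - \<rho> * (s' - s + 0))
      \<le> liminf (\<lambda>n. ereal (\<kappa> * dist (U (k n) s) (U (k n) s') + kinetic_upto (k n) s + - \<rho> * (s' - s + f n)))"
    by (rule liminf_add_ge[OF _ liminf_tendsto_ge])
  also have "\<dots> \<le> liminf (\<lambda>n. ereal (kinetic_upto (k n) s'))"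
  proof (rule Liminf_mono, rule always_eventually, rule allI)
    fix n
    show "ereal (\<kappa> * dist (U (k n) s) (U (k n) s') + kinetic_upto (k n) s + - \<rho> * (s' - s + f n)) \<le> ereal (kinetic_upto (k n) s')"
      using interpolant_energy_bound[OF c s, of "k n", folded \<kappa>_def \<rho>_def f_def]
      unfolding ereal_less_eq by linarith
  qed
  also have "\<dots> = ereal (E s')" using E_eq[of s'] s by simp
  finally show ?thesis unfolding \<kappa>_def \<rho>_def by simp
qed

lemma bounded_interpolants:
  assumes "s \<in> {0..T}"
  shows "bounded (range (\<lambda>n. U n s))"
proof -
  obtain M where M: "\<And>n m. m \<le> N n \<Longrightarrow> kinetic p (t n) (u n) m \<le> M" using uniform_bounds by blast
  obtain f where f: "\<And>n. norm (fineness (N n) (t n)) \<le> f"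
    using convergent_imp_bounded[OF fine] unfolding bounded_iff by blast
  obtain x r where r: "\<And>n. dist x (u n 0) \<le> r"
    using initial_bounded unfolding bounded_def by blast
  have "dist x (U n s) \<le> r + (M + (p - 1) * (s + f)) / p" for n
  proof -
    have "p * dist (U n 0) (U n s) \<le> (kinetic_upto n s - kinetic_upto n 0) + (p - 1) * (s - 0 + fineness (N n) (t n))"
      using interpolant_energy_bound[of 1 0 s n] assms by simp
    also have "\<dots> \<le> M + (p - 1) * (s + f)"
      using M[OF \<iota>_le[OF assms], of n] f[of n] p
      by (intro add_mono mult_left_mono) (auto simp: kinetic_upto_def \<iota>_0 kinetic_def abs_le_iff)
    finally have "dist (U n 0) (U n s) \<le> (M + (p - 1) * (s + f)) / p"
      using p by (simp add: field_simps)
    then show ?thesis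
      using r[of n] dist_triangle[of x "U n s" "U n 0"] by (simp add: U_def \<iota>_0)
  qed
  then show ?thesis unfolding bounded_def by (intro exI[of _ x]) blast
qed

lemma w_sublevel: "\<exists>C. \<forall>s\<in>{0..T}. \<phi> (w s) \<le> ereal C \<and> (\<forall>n. \<phi> (U n s) \<le> ereal C)"
proof -
  obtain C where C: "\<And>n s. s \<in> {0..T} \<Longrightarrow> \<phi> (U n s) \<le> ereal C" using uniform_bounds by blast
  have "\<phi> (w s) \<le> ereal C" if "s \<in> {0..T}" for s
    using C[OF that] by (intro sublevel_limit[OF compat compact conv[OF that]]) simp
  then show ?thesis using C by blast
qed

text \<open>The slope is lower semicontinuous on bounded parts of sublevels, and all values of the interpolants
  at one time form such a part.\<close>

lemma slope_le_liminf:
  assumes s: "s \<in> {0..T}"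
  shows "local_slope \<phi> (w s) \<le> liminf (\<lambda>n. local_slope \<phi> (U (k n) s))"
proof -
  obtain C where C: "\<And>s. s \<in> {0..T} \<Longrightarrow> \<phi> (w s) \<le> ereal C \<and> (\<forall>n. \<phi> (U n s) \<le> ereal C)"
    using w_sublevel by blast
  define B where "B = insert (w s) (range (\<lambda>n. U n s))"
  have "bounded B" unfolding B_def using bounded_interpolants[OF s] by simp
  then have "seq_lsc_on \<sigma> (sublevel \<phi> C \<inter> B) (local_slope \<phi>)" by (rule slope_lsc)
  moreover have "range (\<lambda>n. U (k n) s) \<subseteq> sublevel \<phi> C \<inter> B" "w s \<in> sublevel \<phi> C \<inter> B"
    using C[OF s] by (auto simp: B_def sublevel_def)
  ultimately show ?thesis using conv[OF s] unfolding seq_lsc_on_def by blast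
qed

definition slope_energy :: "real \<Rightarrow> ennreal" where
  "slope_energy s = (\<integral>\<^sup>+r\<in>{0..s}. ennreal_powr (local_slope \<phi> (w r)) q \<partial>lborel)"

definition slope_power :: "nat \<Rightarrow> nat \<Rightarrow> real" where
  "slope_power n i = enn2real (local_slope \<phi> (u n i)) powr q"

text \<open>The integrand of the slope term along the interpolant as a step function, which makes it
  borel; its value at time \<open>0\<close> is \<open>0\<close>, whatever the slope of the initial datum.\<close>

definition slope_steps :: "nat \<Rightarrow> real \<Rightarrow> ennreal" where
  "slope_steps n r = (\<Sum>i=1..N n. ennreal (slope_power n i) * indicator {t n (i - 1)<..t n i} r)"

lemma slope_steps_eq:
  assumes r: "0 < r" "r \<le> T"
  shows "slope_steps n r = ennreal_powr (local_slope \<phi> (U n r)) q"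
proof -
  have i: "\<iota> n r \<in> {1..N n}" unfolding \<iota>_def by (rule idx_pos[OF part r])
  have ind: "indicator {t n (i - 1)<..t n i} r = (if i = \<iota> n r then 1 else (0 :: ennreal))"
    if "i \<in> {1..N n}" for i
  proof (cases "i = \<iota> n r")
    case True
    then show ?thesis using idx_interval[OF part r, of n] by (simp add: \<iota>_def)
  next
    case False
    then have "r \<notin> {t n (i - 1)<..t n i}" using idx_unique[OF part that] unfolding \<iota>_def by blast
    then show ?thesis using False by simp
  qed
  have "slope_steps n r = (\<Sum>i\<in>{1..N n}. if i = \<iota> n r then ennreal (slope_power n i) else 0)"
    unfolding slope_steps_def
  proof (rule sum.cong[OF refl])
    fix i assume "i \<in> {1..N n}"
    then show "ennreal (slope_power n i) * indicator {t n (i - 1)<..t n i} r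
        = (if i = \<iota> n r then ennreal (slope_power n i) else 0)"
      by (simp only: ind) (cases "i = \<iota> n r", simp_all)
  qed
  also have "\<dots> = ennreal (slope_power n (\<iota> n r))"
    using i by (simp only: sum.delta finite_atLeastAtMost if_True)
  also have "\<dots> = ennreal_powr (local_slope \<phi> (U n r)) q"
  proof -
    have "local_slope \<phi> (u n (\<iota> n r)) \<noteq> \<infinity>" using slope_dom[OF i] by (auto simp: slope_dom_def)
    then show ?thesis by (simp only: slope_power_def U_def ennreal_powr_def if_False)
  qed
  finally show ?thesis .
qed

text \<open>Only an inequality, because the sum includes the whole cell of \<open>s\<close>.\<close>

lemma integral_slope_steps:
  assumes s: "s \<in> {0..T}"
  shows "(\<integral>\<^sup>+r\<in>{0..s}. slope_steps n r \<partial>lborel) \<le> ennreal (slope_sum q \<phi> (t n) (u n) (\<iota> n s))"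
proof -
  define x where "x i = slope_power n i" for i
  have i: "\<iota> n s \<le> N n" using \<iota>_le[OF s] .
  have "(\<integral>\<^sup>+r\<in>{0..s}. slope_steps n r \<partial>lborel)
      = (\<integral>\<^sup>+r. (\<Sum>i=1..N n. ennreal (x i) * indicator ({t n (i - 1)<..t n i} \<inter> {0..s}) r) \<partial>lborel)"
    unfolding slope_steps_def x_def sum_distrib_right
    by (simp only: mult.assoc indicator_inter_arith)
  also have "\<dots> = (\<Sum>i=1..N n. ennreal (x i) * emeasure lborel ({t n (i - 1)<..t n i} \<inter> {0..s}))"
  proof -
    have "(\<integral>\<^sup>+r. (\<Sum>i=1..N n. ennreal (x i) * indicator ({t n (i - 1)<..t n i} \<inter> {0..s}) r) \<partial>lborel)
        = (\<Sum>i=1..N n. \<integral>\<^sup>+r. ennreal (x i) * indicator ({t n (i - 1)<..t n i} \<inter> {0..s}) r \<partial>lborel)"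
      by (rule nn_integral_sum) measurable
    also have "\<dots> = (\<Sum>i=1..N n. ennreal (x i) * emeasure lborel ({t n (i - 1)<..t n i} \<inter> {0..s}))"
      by (rule sum.cong[OF refl], rule nn_integral_cmult_indicator) simp
    finally show ?thesis .
  qed
  also have "\<dots> \<le> (\<Sum>i=1..N n. if i \<in> {1..\<iota> n s} then ennreal (step (t n) i * x i) else 0)"
  proof (rule sum_mono)
    fix i assume i: "i \<in> {1..N n}"
    have st: "0 < step (t n) i" using step_pos[OF part i] .
    show "ennreal (x i) * emeasure lborel ({t n (i - 1)<..t n i} \<inter> {0..s})
        \<le> (if i \<in> {1..\<iota> n s} then ennreal (step (t n) i * x i) else 0)"
    proof (cases "i \<le> \<iota> n s")
      case True
      have "emeasure lborel ({t n (i - 1)<..t n i} \<inter> {0..s}) \<le> emeasure lborel {t n (i - 1)<..t n i}"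
        by (intro emeasure_mono) auto
      also have "\<dots> = ennreal (step (t n) i)" using st by (simp add: step_def)
      finally have "ennreal (x i) * emeasure lborel ({t n (i - 1)<..t n i} \<inter> {0..s}) \<le> ennreal (x i) * ennreal (step (t n) i)"
        by (rule mult_left_mono) simp
      also have "\<dots> = ennreal (step (t n) i * x i)"
        using st by (simp add: ennreal_mult x_def slope_power_def mult.commute)
      finally show ?thesis using True i by simp
    next
      case False
      then have "t n (\<iota> n s) \<le> t n (i - 1)"
        using i by (intro partition_mono[OF part]) auto
      moreover have "s \<le> t n (\<iota> n s)" using le_idx[OF part, of s n] s by (simp add: \<iota>_def)
      ultimately have "{t n (i - 1)<..t n i} \<inter> {0..s} = {}" by auto
      then show ?thesis by simp
    qed
  qed
  also have "\<dots> = (\<Sum>i\<in>{1..\<iota> n s}. ennreal (step (t n) i * x i))"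
    using i by (intro sum.mono_neutral_cong_right) auto
  also have "\<dots> = ennreal (\<Sum>i\<in>{1..\<iota> n s}. step (t n) i * x i)"
  proof (rule sum_ennreal)
    fix j assume "j \<in> {1..\<iota> n s}"
    then have "0 < step (t n) j" using step_pos[OF part, of j n] i by auto
    then show "0 \<le> step (t n) j * x j" by (simp add: x_def slope_power_def)
  qed
  finally show ?thesis
    by (simp only: slope_sum_def x_def slope_power_def)
qed

lemma slope_energy_le:
  assumes s: "s \<in> {0..T}"
  shows "slope_energy s \<le> liminf (\<lambda>n. ennreal (slope_sum q \<phi> (t (k n)) (u (k n)) (\<iota> (k n) s)))"
proof -
  have [measurable]: "slope_steps n \<in> borel_measurable borel" for n unfolding slope_steps_def by measurable
  have "AE r in lborel. r \<noteq> (0::real)" by (rule AE_lborel_singleton)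
  then have "slope_energy s \<le> (\<integral>\<^sup>+r. liminf (\<lambda>n. slope_steps (k n) r * indicator {0..s} r) \<partial>lborel)"
    unfolding slope_energy_def
  proof (intro nn_integral_mono_AE, eventually_elim)
    case (elim r)
    have "ennreal_powr (local_slope \<phi> (w r)) q \<le> liminf (\<lambda>n. slope_steps (k n) r)" if r: "r \<in> {0..s}"
    proof -
      have "slope_steps (k n) r = ennreal_powr (local_slope \<phi> (U (k n) r)) q" for n
        using r elim s by (intro slope_steps_eq) auto
      moreover have "local_slope \<phi> (w r) \<le> liminf (\<lambda>n. local_slope \<phi> (U (k n) r))"
        using r s by (intro slope_le_liminf) auto
      ultimately show ?thesis using ennreal_powr_le_liminf[of q] q by simp
    qed
    then show ?case by (auto split: split_indicator)
  qed
  also have "\<dots> \<le> liminf (\<lambda>n. \<integral>\<^sup>+r\<in>{0..s}. slope_steps (k n) r \<partial>lborel)"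
    by (rule nn_integral_liminf) measurable
  also have "\<dots> \<le> liminf (\<lambda>n. ennreal (slope_sum q \<phi> (t (k n)) (u (k n)) (\<iota> (k n) s)))"
    using integral_slope_steps[OF s] by (intro Liminf_mono always_eventually allI)
  finally show ?thesis .
qed

lemma w_finite: "s \<in> {0..T} \<Longrightarrow> ereal (R (w s)) = \<phi> (w s)"
proof -
  assume "s \<in> {0..T}"
  then obtain C where "\<phi> (w s) \<le> ereal C" using w_sublevel by blast
  then show ?thesis using proper[of "w s"] by (cases "\<phi> (w s)") auto
qed

text \<open>Each of the three terms is at most the lower limit of its discrete counterpart, and the sum of the lower limits is at most
  the lower limit of the sums, which the discrete energy inequality controls.\<close>

theorem limit_energy_inequality:
  assumes s: "s \<in> {0..T}"
  shows "slope_energy s < \<infinity>"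
    and "R (w s) + E s / p + enn2real (slope_energy s) / q \<le> R u0"
proof -
  define x where "x n = slope_sum q \<phi> (t (k n)) (u (k n)) (\<iota> (k n) s)" for n
  obtain M where M: "\<And>n m. m \<le> N n \<Longrightarrow> slope_sum q \<phi> (t n) (u n) m \<le> M" using uniform_bounds by blast
  have x: "0 \<le> x n" "x n \<le> M" for n
    using slope_sum_nonneg[OF \<iota>_le[OF s]] M[OF \<iota>_le[OF s]] by (auto simp: x_def)
  have le: "slope_energy s \<le> liminf (\<lambda>n. ennreal (x n))" unfolding x_def by (rule slope_energy_le[OF s])
  also have "\<dots> \<le> liminf (\<lambda>n. ennreal M)"
    using x by (intro Liminf_mono always_eventually) (auto intro: ennreal_leI)
  also have "\<dots> = ennreal M" by (rule Liminf_const) simp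
  finally show fin: "slope_energy s < \<infinity>" by (rule order_le_less_trans) simp
  have "ereal (enn2real (slope_energy s)) \<le> liminf (\<lambda>n. ereal (x n))"
    unfolding le_Liminf_iff
  proof (intro allI impI)
    fix y assume y: "y < ereal (enn2real (slope_energy s))"
    show "\<forall>\<^sub>F n in sequentially. y < ereal (x n)"
    proof (cases "y < 0")
      case True
      then show ?thesis using x(1) by (intro always_eventually allI) (metis ereal_less_eq(5) order_less_le_trans)
    next
      case False
      then obtain y' where y': "y = ereal y'" "0 \<le> y'" using y by (cases y) auto
      have "ennreal y' < slope_energy s"
        using y y' fin by (metis ennreal_enn2real ennreal_less_iff ereal_less_eq(3) infinity_ennreal_def less_ereal.simps(1))
      then have "ennreal y' < liminf (\<lambda>n. ennreal (x n))" using le by (rule order_less_le_trans)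
      then have "\<forall>\<^sub>F n in sequentially. ennreal y' < ennreal (x n)" by (rule less_LiminfD)
      then show ?thesis by eventually_elim (use y' in \<open>simp add: ennreal_less_iff\<close>)
    qed
  qed
  from liminf_cmult_ge[OF this, of "1 / q"] q
  have "ereal (1 / q * enn2real (slope_energy s)) \<le> liminf (\<lambda>n. ereal (1 / q * x n))" by simp
  moreover have "ereal (1 / p * E s) \<le> liminf (\<lambda>n. ereal (1 / p * kinetic_upto (k n) s))"
    using E_eq[OF s] p by (intro liminf_cmult_ge) auto
  moreover have "ereal (R (w s)) \<le> liminf (\<lambda>n. ereal (R (U (k n) s)))"
  proof -
    have "ereal (R (U (k n) s)) = \<phi> (U (k n) s)" for n
      unfolding U_def using u_eff_dom[OF \<iota>_le[OF s]] by (rule R_finite)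
    then show ?thesis
      using functional_lsc[OF compat compact conv[OF s]] w_finite[OF s] by simp
  qed
  ultimately have "ereal (R (w s) + 1 / p * E s + 1 / q * enn2real (slope_energy s))
      \<le> liminf (\<lambda>n. ereal (R (U (k n) s) + 1 / p * kinetic_upto (k n) s + 1 / q * x n))"
    by (intro liminf_add_ge)
  also have "\<dots> \<le> liminf (\<lambda>n. ereal (R (u (k n) 0) + err (k n)))"
    using energy_inequality[OF \<iota>_le[OF s]]
    by (intro Liminf_mono always_eventually) (auto simp: U_def kinetic_upto_def x_def)
  also have "\<dots> = ereal (R u0)"
    using budget_tendsto_k by (intro lim_imp_Liminf) auto
  finally show "R (w s) + E s / p + enn2real (slope_energy s) / q \<le> R u0" by simp
qed

text \<open>The strong upper gradient inequality together with Young's inequality reverses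
  \<open>limit_energy_inequality\<close>.  Both are therefore equalities, also with \<open>\<integral>\<bar>w'\<bar>\<^sup>p\<close> in place
  of \<open>E\<close>, and \<open>\<phi> \<circ> w\<close> is a primitive.\<close>

theorem limit_is_curve_of_maximal_slope: "curve_of_maximal_slope p q T \<phi> w"
proof -
  obtain g where g[measurable]: "g \<in> borel_measurable borel" and g0: "\<And>x. 0 \<le> g x"
    and g_deriv: "AE x in lborel. x \<in> {0<..<T} \<longrightarrow> ((\<lambda>s. dist (w s) (w x) / \<bar>x - s\<bar>) \<longlongrightarrow> g x) (at x)"
    and g_dist: "\<And>s t. 0 \<le> s \<Longrightarrow> s \<le> t \<Longrightarrow> t \<le> T \<Longrightarrow> dist (w s) (w t) \<le> (LINT r:{s..t}|lborel. g r)"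
    and g_energy: "\<And>t. 0 \<le> t \<Longrightarrow> t \<le> T \<Longrightarrow> (\<integral>\<^sup>+r\<in>{0..t}. ennreal (g r powr p) \<partial>lborel) \<le> ennreal (E t - E 0)"
    by (rule metric_derivative_energy[OF p less_imp_le[OF T], of E w]) (use E_mono E_increment in blast)+
  have ends: "AE r in lborel. r \<noteq> 0 \<and> r \<noteq> T"
    using AE_lborel_singleton[of 0] AE_lborel_singleton[of T] by eventually_elim auto
  have deriv: "AE r in lborel. r \<in> {0..T} \<longrightarrow> metric_deriv w r = g r"
    using g_deriv ends
  proof eventually_elim
    case (elim r)
    then show ?case unfolding metric_deriv_def by (auto intro!: tendsto_Lim)
  qed
  have AC: "AC p T w"
    unfolding AC_def
  proof (intro exI[of _ g] conjI allI impI)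
    have "integrable lborel (\<lambda>r. indicator {0..T} r * g r powr p)"
    proof (rule integrableI_nonneg)
      have "(\<integral>\<^sup>+r. ennreal (indicator {0..T} r * g r powr p) \<partial>lborel) = (\<integral>\<^sup>+r\<in>{0..T}. ennreal (g r powr p) \<partial>lborel)"
        by (intro nn_integral_cong) (auto split: split_indicator)
      also have "\<dots> \<le> ennreal (E T - E 0)" using g_energy[of T] T by simp
      finally show "(\<integral>\<^sup>+r. ennreal (indicator {0..T} r * g r powr p) \<partial>lborel) < \<infinity>"
        by (rule order_le_less_trans) simp
    qed auto
    then have "set_integrable lborel {0..T} (\<lambda>r. \<bar>g r\<bar> powr p)"
      using g0 by (simp add: set_integrable_def)
    then have "set_integrable lborel {0<..<T} (\<lambda>r. \<bar>g r\<bar> powr p)"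
      by (rule set_integrable_subset) auto
    then show "Lp_fun p T g" unfolding Lp_fun_def by (auto simp: set_borel_measurable_def)
  qed (use g_dist in auto)
  \<comment> \<open>The slope along \<open>w\<close> is known to be borel on \<open>{0..T}\<close> only.\<close>
  define sl where "sl r = local_slope \<phi> (w r) * indicator {0..T} r" for r
  define Sq where "Sq r = ennreal_powr (sl r) q" for r
  have sl[measurable]: "sl \<in> borel_measurable borel"
    using gradient AC unfolding strong_upper_gradient_def sl_def
    by (subst borel_measurable_restrict_space_iff_ennreal[symmetric]) auto
  have Sq[measurable]: "Sq \<in> borel_measurable borel" unfolding Sq_def ennreal_powr_def by measurable
  have Sq_eq: "Sq r = ennreal_powr (local_slope \<phi> (w r)) q" if "r \<in> {0..T}" for r
    using that by (simp add: Sq_def sl_def)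
  define I where "I s = (\<integral>\<^sup>+r\<in>{0..s}. ennreal (g r powr p) \<partial>lborel)" for s
  define i where "i s = enn2real (I s)" for s
  define \<sigma>' where "\<sigma>' s = enn2real (slope_energy s)" for s
  have I_fin: "ennreal (i s) = I s" "i s \<le> E s" if s: "s \<in> {0..T}" for s
  proof -
    have le: "I s \<le> ennreal (E s)" using g_energy[of s] s E_0 by (simp add: I_def)
    also have "\<dots> < top" by simp
    finally show "ennreal (i s) = I s" by (simp add: i_def)
    have "0 \<le> E s" using E_mono[of 0 s] s E_0 by simp
    then show "i s \<le> E s" using le by (simp add: i_def enn2real_leI)
  qed
  have S_fin: "ennreal (\<sigma>' s) = slope_energy s" if s: "s \<in> {0..T}" for s
    using limit_energy_inequality(1)[OF s] by (simp add: \<sigma>'_def)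
  have S_eq: "slope_energy s = (\<integral>\<^sup>+r\<in>{0..s}. Sq r \<partial>lborel)" if s: "s \<in> {0..T}" for s
    unfolding slope_energy_def using s Sq_eq by (intro nn_integral_cong) (auto split: split_indicator)
  have i0: "0 \<le> i s" "0 \<le> \<sigma>' s" for s by (auto simp: i_def \<sigma>'_def)
  have identity: "R (w s) + i s / p + \<sigma>' s / q = R u0" if s: "s \<in> {0..T}" for s
  proof (rule antisym)
    have "i s / p \<le> E s / p" using I_fin[OF s] p by (intro divide_right_mono) auto
    then show "R (w s) + i s / p + \<sigma>' s / q \<le> R u0"
      using limit_energy_inequality(2)[OF s] by (simp add: \<sigma>'_def)
    have "(\<integral>\<^sup>+r\<in>{0..s}. (local_slope \<phi> (w r) * ennreal (metric_deriv w r)) \<partial>lborel)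
        \<le> (\<integral>\<^sup>+r. ennreal (1 / p) * (ennreal (g r powr p) * indicator {0..s} r) + ennreal (1 / q) * (Sq r * indicator {0..s} r) \<partial>lborel)"
      using deriv
    proof (intro nn_integral_mono_AE, eventually_elim)
      case (elim r)
      show ?case
      proof (cases "r \<in> {0..s}")
        case True
        then have r: "r \<in> {0..T}" using s by auto
        have "local_slope \<phi> (w r) * ennreal (g r) \<le> ennreal (1 / p) * ennreal (g r powr p) + ennreal (1 / q) * Sq r"
          unfolding Sq_eq[OF r] using p q pq g0 by (rule ennreal_Young)
        then show ?thesis using True elim r by simp
      qed simp
    qed
    also have "\<dots> = ennreal (1 / p) * I s + ennreal (1 / q) * slope_energy s"
      unfolding S_eq[OF s] I_def by (simp add: nn_integral_add nn_integral_cmult)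
    also have "\<dots> = ennreal (i s / p + \<sigma>' s / q)"
      using i0 p q by (simp add: I_fin(1)[OF s, symmetric] S_fin[OF s, symmetric] ennreal_mult[symmetric])
    finally have "enn2ereal (\<integral>\<^sup>+r\<in>{0..s}. (local_slope \<phi> (w r) * ennreal (metric_deriv w r)) \<partial>lborel)
        \<le> enn2ereal (ennreal (i s / p + \<sigma>' s / q))"
      by (simp only: less_eq_ennreal.rep_eq)
    moreover have "abs_diff (\<phi> (w s)) (\<phi> (w 0))
        \<le> enn2ereal (\<integral>\<^sup>+r\<in>{0..s}. (local_slope \<phi> (w r) * ennreal (metric_deriv w r)) \<partial>lborel)"
      using gradient AC s unfolding strong_upper_gradient_def by auto
    ultimately have "abs_diff (\<phi> (w s)) (\<phi> (w 0)) \<le> ereal (i s / p + \<sigma>' s / q)"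
      using i0 p q by (simp add: enn2ereal_ennreal del: ennreal_plus)
    moreover have "abs_diff (\<phi> (w s)) (\<phi> (w 0)) = ereal \<bar>R (w s) - R u0\<bar>"
    proof -
      have "abs_diff (ereal x) (ereal y) = ereal \<bar>x - y\<bar>" for x y by (simp add: abs_diff_def)
      from this[of "R (w s)" "R (w 0)"] show ?thesis
        using w_finite[OF s] w_finite[of 0] T by (simp add: w_0)
    qed
    ultimately show "R u0 \<le> R (w s) + i s / p + \<sigma>' s / q" by simp
  qed
  have energy_identity: "\<phi> (w s)
        + enn2ereal (ennreal (1/p) * (\<integral>\<^sup>+r\<in>{0..s}. ennreal (metric_deriv w r powr p) \<partial>lborel))
        + enn2ereal (ennreal (1/q) * (\<integral>\<^sup>+r\<in>{0..s}. ennreal_powr (local_slope \<phi> (w r)) q \<partial>lborel))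
        = \<phi> (w 0)" if s: "s \<in> {0..T}" for s
  proof -
    have "(\<integral>\<^sup>+r\<in>{0..s}. ennreal (metric_deriv w r powr p) \<partial>lborel) = I s"
      unfolding I_def using deriv
      by (intro nn_integral_cong_AE, eventually_elim) (use s in \<open>auto split: split_indicator\<close>)
    then have e1: "enn2ereal (ennreal (1/p) * (\<integral>\<^sup>+r\<in>{0..s}. ennreal (metric_deriv w r powr p) \<partial>lborel)) = ereal (i s / p)"
      using i0 p by (simp add: I_fin(1)[OF s, symmetric] ennreal_mult[symmetric] enn2ereal_ennreal)
    have e2: "enn2ereal (ennreal (1/q) * slope_energy s) = ereal (\<sigma>' s / q)"
      using i0 q by (simp add: S_fin[OF s, symmetric] ennreal_mult[symmetric] enn2ereal_ennreal)
    have e3: "ereal (R (w s)) = \<phi> (w s)" "ereal (R u0) = \<phi> (w 0)"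
      using w_finite[OF s] w_finite[of 0] T by (simp_all add: w_0)
    have "ereal (R (w s)) + ereal (i s / p) + ereal (\<sigma>' s / q) = ereal (R u0)"
      using identity[OF s] by simp
    then show ?thesis
      unfolding slope_energy_def[symmetric] by (simp only: e1 e2 e3)
  qed
  define \<kappa> where "\<kappa> r = g r powr p / p + enn2real (Sq r) / q" for r
  have \<kappa>0: "0 \<le> \<kappa> r" for r using p q by (simp add: \<kappa>_def)
  have [measurable]: "\<kappa> \<in> borel_measurable borel" unfolding \<kappa>_def by measurable
  have T_in: "T \<in> {0..T}" using T by simp
  have "AE r in lborel. Sq r * indicator {0..T} r \<noteq> \<infinity>"
    by (rule nn_integral_PInf_AE) (use limit_energy_inequality(1)[OF T_in] S_eq[OF T_in] in auto)
  then have Sq_fin: "AE r in lborel. r \<in> {0..T} \<longrightarrow> ennreal (enn2real (Sq r)) = Sq r"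
    by eventually_elim (auto simp: less_top split: split_indicator)
  have \<kappa>_nn: "(\<integral>\<^sup>+r. ennreal (indicator {0..s} r * \<kappa> r) \<partial>lborel) = ennreal (i s / p + \<sigma>' s / q)"
    if s: "s \<in> {0..T}" for s
  proof -
    have "(\<integral>\<^sup>+r. ennreal (indicator {0..s} r * \<kappa> r) \<partial>lborel)
      = (\<integral>\<^sup>+r. ennreal (1 / p) * (ennreal (g r powr p) * indicator {0..s} r) + ennreal (1 / q) * (Sq r * indicator {0..s} r) \<partial>lborel)"
      using Sq_fin
    proof (intro nn_integral_cong_AE, eventually_elim)
      case (elim r)
      show ?case
      proof (cases "r \<in> {0..s}")
        case True
        then have "Sq r = ennreal (enn2real (Sq r))" using elim s by auto
        then have "ennreal (1 / p) * ennreal (g r powr p) + ennreal (1 / q) * Sq r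
          = ennreal (1 / p) * ennreal (g r powr p) + ennreal (1 / q) * ennreal (enn2real (Sq r))" by simp
        also have "\<dots> = ennreal (\<kappa> r)"
          using p q by (simp add: \<kappa>_def ennreal_mult[symmetric] ennreal_plus[symmetric] del: ennreal_plus)
        finally show ?thesis using True by simp
      qed simp
    qed
    also have "\<dots> = ennreal (1 / p) * I s + ennreal (1 / q) * slope_energy s"
      unfolding S_eq[OF s] I_def by (simp add: nn_integral_add nn_integral_cmult)
    also have "\<dots> = ennreal (i s / p + \<sigma>' s / q)"
      using i0 p q by (simp add: I_fin(1)[OF s, symmetric] S_fin[OF s, symmetric] ennreal_mult[symmetric])
    finally show ?thesis .
  qed
  have \<kappa>_int: "set_integrable lborel {0..T} \<kappa>"
    unfolding set_integrable_def real_scaleR_def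
    by (rule integrableI_nonneg) (use \<kappa>_nn[OF T_in] \<kappa>0 in auto)
  have primitive: "R (w s) = R u0 - (LINT r:{0..s}|lborel. \<kappa> r)" if s: "s \<in> {0..T}" for s
  proof -
    have "(LINT r:{0..s}|lborel. \<kappa> r) = enn2real (\<integral>\<^sup>+r. ennreal (indicator {0..s} r * \<kappa> r) \<partial>lborel)"
      unfolding set_lebesgue_integral_def real_scaleR_def
      by (rule integral_eq_nn_integral) (use \<kappa>0 in auto)
    also have "\<dots> = i s / p + \<sigma>' s / q"
      using \<kappa>_nn[OF s] i0 p q by (simp del: ennreal_plus)
    finally show ?thesis using identity[OF s] by simp
  qed
  have K_mono: "(LINT r:{0..s}|lborel. \<kappa> r) \<le> (LINT r:{0..s'}|lborel. \<kappa> r)" if "s \<le> s'" "s' \<le> T" for s s'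
  proof -
    have "integrable lborel (\<lambda>r. indicator {0..x} r *\<^sub>R \<kappa> r)" if "x \<le> T" for x
      using set_integrable_subset[OF \<kappa>_int, of "{0..x}"] that by (simp add: set_integrable_def)
    then show ?thesis unfolding set_lebesgue_integral_def
      by (intro integral_mono) (use that \<kappa>0 in \<open>auto split: split_indicator\<close>)
  qed
  have W: "W11 T (\<lambda>t. \<phi> (w t))"
    unfolding W11_def
  proof (intro conjI exI[of _ "\<lambda>r. - \<kappa> r"] allI impI)
    have "\<bar>\<phi> (w x)\<bar> \<noteq> \<infinity>" if "x \<in> {0<..<T}" for x
    proof -
      have e: "ereal (R (w x)) = \<phi> (w x)" using that by (intro w_finite) auto
      show ?thesis by (subst e[symmetric]) simp
    qed
    then show "AE x in lborel. x \<in> {0<..<T} \<longrightarrow> \<bar>\<phi> (w x)\<bar> \<noteq> \<infinity>" by simp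
    \<comment> \<open>A monotone extension to the line, hence borel and bounded.\<close>
    define h where "h x = (LINT r:{0..max 0 (min T x)}|lborel. \<kappa> r)" for x
    have "mono h" unfolding h_def mono_def using K_mono T by auto
    then have [measurable]: "h \<in> borel_measurable borel" by (rule borel_measurable_mono)
    have hx: "h x \<le> h T" "h 0 \<le> h x" for x unfolding h_def by (rule K_mono; use T in simp)+
    have h0: "0 \<le> h 0" unfolding h_def using \<kappa>0 by (auto simp: set_lebesgue_integral_def intro!: integral_nonneg_AE)
    have h: "\<bar>h x\<bar> \<le> h T" for x using h0 hx[of x] by linarith
    have "integrable lborel (\<lambda>x. indicator {0<..<T} x *\<^sub>R (R u0 - h x))"
      by (rule integrableI_bounded_set_indicator[where B = "\<bar>R u0\<bar> + h T"])
         (use h T in \<open>auto intro!: AE_I2 order_trans[OF abs_triangle_ineq4] add_left_mono\<close>)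
    moreover have "indicator {0<..<T} x *\<^sub>R (R u0 - h x) = indicator {0<..<T} x *\<^sub>R R (w x)" for x
      using primitive[of x] by (auto simp: h_def split: split_indicator)
    ultimately show "set_integrable lborel {0<..<T} (\<lambda>x. R (w x))" by (simp only: set_integrable_def)
    show "set_integrable lborel {0<..<T} (\<lambda>r. - \<kappa> r)"
      using set_integrable_subset[OF \<kappa>_int, of "{0<..<T}"] by (auto simp: set_integrable_def greaterThanLessThan_subseteq_atLeastAtMost_iff)
    fix \<zeta> assume \<zeta>: "test_function T \<zeta>"
    have "(LINT x:{0<..<T}|lborel. R (w x) * deriv \<zeta> x)
        = (LINT x:{0<..<T}|lborel. (R u0 - (LINT r:{0..x}|lborel. \<kappa> r)) * deriv \<zeta> x)"
      using primitive by (intro set_lebesgue_integral_cong) auto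
    also have "\<dots> = (LINT x:{0<..<T}|lborel. \<kappa> x * \<zeta> x)"
      by (rule integral_primitive_times_deriv[OF T \<kappa>_int \<zeta>])
    also have "\<dots> = - (LINT x:{0<..<T}|lborel. - \<kappa> x * \<zeta> x)"
      by (simp add: set_lebesgue_integral_def)
    finally show "(LINT x:{0<..<T}|lborel. R (w x) * deriv \<zeta> x) = - (LINT x:{0<..<T}|lborel. - \<kappa> x * \<zeta> x)" .
  qed
  show ?thesis
    unfolding curve_of_maximal_slope_def using AC W energy_identity by blast
qed

end

theorem theorem3p1:
  fixes p q T :: real
    and \<sigma> :: "'a::complete_space topology"
    and \<phi> :: "'a \<Rightarrow> ereal"
    and u0 :: 'a
    and N :: "nat \<Rightarrow> nat"
    and t :: "nat \<Rightarrow> nat \<Rightarrow> real"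
    and u :: "nat \<Rightarrow> nat \<Rightarrow> 'a"
  assumes "p > 1" and "q > 1" and "1 / p + 1 / q = 1" and "T > 0"
    and "topspace \<sigma> = UNIV" and "Hausdorff_space \<sigma>" and "dist_compatible \<sigma>"
    and "\<And>x. \<phi> x \<noteq> -\<infinity>" and "eff_dom \<phi> \<noteq> {}"
    and "\<And>c. seq_compact_in \<sigma> (sublevel \<phi> c)"
    and "strong_upper_gradient p T \<phi> (local_slope \<phi>)"
    and "\<And>c B. bounded B \<Longrightarrow> seq_lsc_on \<sigma> (sublevel \<phi> c \<inter> B) (local_slope \<phi>)"
    and "u0 \<in> eff_dom \<phi>"
    and "\<And>n. time_partition T (N n) (t n)"
    and "(\<lambda>n. fineness (N n) (t n)) \<longlonglongrightarrow> 0"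
    and "\<And>n. u n 0 \<in> eff_dom \<phi>"
    and "\<And>n i. i \<in> {1..N n} \<Longrightarrow> u n i \<in> slope_dom \<phi>"
    and "bounded (range (\<lambda>n. u n 0))"
    and "limitin \<sigma> (\<lambda>n. u n 0) u0 sequentially"
    and "(\<lambda>n. \<phi> (u n 0)) \<longlonglongrightarrow> \<phi> u0"
    and "(\<lambda>n. \<Sum>i=1..N n. max 0 (incr_G p q \<phi> (step (t n) i) (u n (i - 1)) (u n i)))
           \<longlonglongrightarrow> 0"
  shows "\<exists>k w. strict_mono k \<and>
           (\<forall>s\<in>{0..T}. limitin \<sigma>
              (\<lambda>n. backward_interp (N (k n)) (t (k n)) (u (k n)) s) (w s) sequentially) \<and>
           curve_of_maximal_slope p q T \<phi> w \<and> w 0 = u0"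
proof -
  interpret discrete_flow p q T \<sigma> \<phi> u0 N t u
    by (rule discrete_flow.intro) (fact assms)+
  from interpolants_converge obtain k w where k: "strict_mono k"
    and conv: "\<forall>s\<in>{0..T}. limitin \<sigma> (\<lambda>n. U (k n) s) (w s) sequentially" by blast
  interpret flow_limit p q T \<sigma> \<phi> u0 N t u k w
    by unfold_locales (use k conv in blast)+
  show ?thesis
  proof (rule exI[of _ k], rule exI[of _ w], intro conjI ballI)
    fix s assume s: "s \<in> {0..T}"
    show "limitin \<sigma> (\<lambda>n. backward_interp (N (k n)) (t (k n)) (u (k n)) s) (w s) sequentially"
      unfolding U_eq[OF s] by (rule conv[OF s])
  qed (fact k limit_is_curve_of_maximal_slope w_0)+
qed

end
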